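(* Let $K$ be a field. The space $\mathcal{H}_{\mathcal{DP}}$ is given a Hopf algebra structure with the product $\rightsquigarrow$ and the coproduct defined, for any double poset $P$, by $$\Delta(P)=\sum_{I \text{ ideal of } P}(P\setminus I)\otimes I.$$ This Hopf algebra is graded by the cardinality of the double posets. Moreover, $(\mathcal{H}_{\mathcal{DP}},\natural,\Delta)$ is an infinitesimal Hopf algebra.
   Context: A double poset is a triple $(P,\leq_1,\leq_2)$ where $P$ is a finite set and $\leq_1,\leq_2$ are two partial orders on $P$. $\mathcal{DP}$ is the set of isomorphism classes of double posets (double posets are identified with their classes); the class of the empty double poset is denoted $1$. $\mathcal{H}_{\mathcal{DP}}$ is the $K$-vector space with basis $\mathcal{DP}$. Subsets of a double poset are double posets with the restricted orders. An ideal of a double poset $P$ is a subset $I\subseteq P$ such that for all $x\in I$, $y\in P$, $x\leq_1 y$ implies $y\in I$. For $P,Q\in\mathcal{DP}$: $P\rightsquigarrow Q$ is the disjoint union of $P$ and $Q$, with $P$ and $Q$ as double subposets, and for all $x\in P$, $y\in Q$: $x\leq_2 y$ and $x,y$ are not comparable for $\leq_1$. Similarly $P\natural Q$ is the disjoint union of $P$ and $Q$, with $P$ and $Q$ as double subposets, and for all $x\in P$, $y\in Q$: $x\leq_1 y$ and $x,y$ are not comparable for $\leq_2$. Both are associative with unit $1$, and extended bilinearly. $(H,m,\Delta)$ is an infinitesimal Hopf algebra (in the sense of Loday and Ronco) if $(H,m)$ is an associative unital algebra, $\Delta$ is a coassociative counital coproduct with $\Delta(1)=1\otimes 1$, it is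 graded and connected, and for all $x,y\in H$, $\Delta(xy)=(x\otimes 1)\Delta(y)+\Delta(x)(1\otimes y)-x\otimes y$, where $H\otimes H$ carries the componentwise product. *)

theory Defs
  imports Complex_Main "HOL-Library.Poly_Mapping"
begin

section \<open>Free vector spaces and their tensor products\<close>

text \<open>
  The vector space with basis \<^typ>\<open>'b\<close> over the field \<^typ>\<open>'k\<close> is the type
  \<^typ>\<open>'b \<Rightarrow>\<^sub>0 'k\<close> of finitely supported functions.
\<close>

definition fscale :: "'k::field \<Rightarrow> ('b \<Rightarrow>\<^sub>0 'k) \<Rightarrow> ('b \<Rightarrow>\<^sub>0 'k)"  (infixr \<open>*\<^sub>K\<close> 75)
  where "c *\<^sub>K x = Poly_Mapping.map ((*) c) x"

lemma lookup_fscale [simp]: "Poly_Mapping.lookup (c *\<^sub>K x) b = c * Poly_Mapping.lookup x b"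
  by (cases "Poly_Mapping.lookup x b = 0") (simp_all add: fscale_def Poly_Mapping.map.rep_eq)

interpretation free: vector_space "fscale :: 'k::field \<Rightarrow> ('b \<Rightarrow>\<^sub>0 'k) \<Rightarrow> ('b \<Rightarrow>\<^sub>0 'k)"
  by unfold_locales (auto intro!: poly_mapping_eqI simp: lookup_add algebra_simps)

abbreviation basis_vec :: "'b \<Rightarrow> ('b \<Rightarrow>\<^sub>0 'k::field)"
  where "basis_vec b \<equiv> Poly_Mapping.single b 1"

definition lin_ext :: "('b \<Rightarrow> ('c \<Rightarrow>\<^sub>0 'k)) \<Rightarrow> ('b \<Rightarrow>\<^sub>0 'k) \<Rightarrow> ('c \<Rightarrow>\<^sub>0 'k::field)"
  where "lin_ext f x = (\<Sum>b\<in>Poly_Mapping.keys x. Poly_Mapping.lookup x b *\<^sub>K f b)"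

abbreviation flinear :: "(('b \<Rightarrow>\<^sub>0 'k) \<Rightarrow> ('c \<Rightarrow>\<^sub>0 'k::field)) \<Rightarrow> bool"
  where "flinear \<equiv> Vector_Spaces.linear fscale fscale"

definition bilin :: "(('a \<Rightarrow>\<^sub>0 'k) \<Rightarrow> ('b \<Rightarrow>\<^sub>0 'k) \<Rightarrow> ('c \<Rightarrow>\<^sub>0 'k::field)) \<Rightarrow> bool"
  where "bilin f \<longleftrightarrow> (\<forall>x. flinear (f x)) \<and> (\<forall>y. flinear (\<lambda>x. f x y))"

text \<open>
  The tensor product of the spaces with bases \<^typ>\<open>'a\<close> and \<^typ>\<open>'b\<close> is modelled by the space with
  basis \<^typ>\<open>'a \<times> 'b\<close>, the basis vector \<open>(a, b)\<close> standing for \<open>a \<otimes> b\<close>. Its universal property is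
  proved below; all maps out of tensor products are defined through \<open>tensor_lift\<close>.
\<close>

definition tensor :: "('a \<Rightarrow>\<^sub>0 'k) \<Rightarrow> ('b \<Rightarrow>\<^sub>0 'k) \<Rightarrow> ('a \<times> 'b \<Rightarrow>\<^sub>0 'k::field)"  (infixr \<open>\<otimes>\<close> 72)
  where "x \<otimes> y = (\<Sum>a\<in>Poly_Mapping.keys x. \<Sum>b\<in>Poly_Mapping.keys y. Poly_Mapping.single (a, b) (Poly_Mapping.lookup x a * Poly_Mapping.lookup y b))"

definition tensor_lift ::
    "(('a \<Rightarrow>\<^sub>0 'k) \<Rightarrow> ('b \<Rightarrow>\<^sub>0 'k) \<Rightarrow> ('c \<Rightarrow>\<^sub>0 'k)) \<Rightarrow> ('a \<times> 'b \<Rightarrow>\<^sub>0 'k) \<Rightarrow> ('c \<Rightarrow>\<^sub>0 'k::field)"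
  where "tensor_lift f = lin_ext (\<lambda>(a, b). f (basis_vec a) (basis_vec b))"

lemma lin_ext_superset:
  assumes "finite A" "Poly_Mapping.keys x \<subseteq> A"
  shows "lin_ext f x = (\<Sum>b\<in>A. Poly_Mapping.lookup x b *\<^sub>K f b)"
  unfolding lin_ext_def using assms
  by (intro sum.mono_neutral_left) (auto simp: in_keys_iff)

lemma flinearI:
  assumes "\<And>x y. f (x + y) = f x + f y" "\<And>c x. f (c *\<^sub>K x) = c *\<^sub>K f x"
  shows "flinear f"
  using assms by unfold_locales auto

lemma flinear_lin_ext:
  fixes f :: "'b \<Rightarrow> ('c \<Rightarrow>\<^sub>0 'k::field)"
  shows "flinear (lin_ext f)"
proof (rule flinearI)
  fix x y :: "'b \<Rightarrow>\<^sub>0 'k"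
  let ?A = "Poly_Mapping.keys x \<union> Poly_Mapping.keys y"
  have "lin_ext f (x + y) = (\<Sum>b\<in>?A. Poly_Mapping.lookup (x + y) b *\<^sub>K f b)"
    by (rule lin_ext_superset) (use keys_add[of x y] in auto)
  also have "\<dots> = lin_ext f x + lin_ext f y"
    by (simp add: lin_ext_superset[of ?A] lookup_add free.scale_left_distrib sum.distrib)
  finally show "lin_ext f (x + y) = lin_ext f x + lin_ext f y" .
next
  fix c and x :: "'b \<Rightarrow>\<^sub>0 'k"
  have "lin_ext f (c *\<^sub>K x) = (\<Sum>b\<in>Poly_Mapping.keys x. Poly_Mapping.lookup (c *\<^sub>K x) b *\<^sub>K f b)"
    by (rule lin_ext_superset) (auto simp: in_keys_iff)
  also have "\<dots> = c *\<^sub>K lin_ext f x"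
    by (simp add: lin_ext_def free.scale_sum_right)
  finally show "lin_ext f (c *\<^sub>K x) = c *\<^sub>K lin_ext f x" .
qed

lemma lin_ext_add: "lin_ext f (x + y) = lin_ext f x + lin_ext f y"
  and lin_ext_scale: "lin_ext f (c *\<^sub>K x) = c *\<^sub>K lin_ext f x"
  using flinear_lin_ext[of f]
  by (simp_all add: Vector_Spaces.linear_def module_hom_def module_hom_axioms_def)

lemma lin_ext_basis [simp]: "lin_ext f (basis_vec b) = f b"
  by (simp add: lin_ext_def)

lemma free_expansion: "x = (\<Sum>b\<in>Poly_Mapping.keys x. Poly_Mapping.lookup x b *\<^sub>K basis_vec b)"
proof (rule poly_mapping_eqI)
  fix a
  have "(\<Sum>b\<in>Poly_Mapping.keys x. Poly_Mapping.lookup x b * Poly_Mapping.lookup (basis_vec b) a) = (\<Sum>b\<in>Poly_Mapping.keys x. if b = a then Poly_Mapping.lookup x b else 0)"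
    by (intro sum.cong) (auto simp: lookup_single)
  also have "\<dots> = Poly_Mapping.lookup x a"
    by (simp add: in_keys_iff)
  finally show "Poly_Mapping.lookup x a = Poly_Mapping.lookup (\<Sum>b\<in>Poly_Mapping.keys x. Poly_Mapping.lookup x b *\<^sub>K basis_vec b) a"
    by (simp add: lookup_sum)
qed

lemma flinear_expand:
  assumes "flinear f"
  shows "f x = (\<Sum>b\<in>Poly_Mapping.keys x. Poly_Mapping.lookup x b *\<^sub>K f (basis_vec b))"
proof -
  interpret f: Vector_Spaces.linear fscale fscale f by fact
  have "f x = f (\<Sum>b\<in>Poly_Mapping.keys x. Poly_Mapping.lookup x b *\<^sub>K basis_vec b)"
    using free_expansion[of x] by simp
  then show ?thesis by (simp add: f.sum f.scale)
qed

lemma single_fscale: "Poly_Mapping.single b (c * d) = c *\<^sub>K Poly_Mapping.single b d"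
  by (rule poly_mapping_eqI) (simp add: lookup_single when_def)

lemma tensor_basis [simp]: "basis_vec a \<otimes> basis_vec b = basis_vec (a, b)"
  by (simp add: tensor_def)

lemma tensor_alt: "x \<otimes> y = lin_ext (\<lambda>a. lin_ext (\<lambda>b. basis_vec (a, b)) y) x"
  unfolding tensor_def lin_ext_def
  by (intro sum.cong refl) (simp add: free.scale_sum_right flip: single_fscale)

lemma lin_ext_add_fun: "lin_ext (\<lambda>a. f a + g a) x = lin_ext f x + lin_ext g x"
  by (simp add: lin_ext_def free.scale_right_distrib sum.distrib)

lemma lin_ext_scale_fun: "lin_ext (\<lambda>a. c *\<^sub>K f a) x = c *\<^sub>K lin_ext f x"
  by (simp add: lin_ext_def free.scale_sum_right mult.commute)

lemma bilin_tensor: "bilin ((\<otimes>) :: ('a \<Rightarrow>\<^sub>0 'k::field) \<Rightarrow> ('b \<Rightarrow>\<^sub>0 'k) \<Rightarrow> _)"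
proof -
  have "flinear (\<lambda>y. x \<otimes> y)" for x :: "'a \<Rightarrow>\<^sub>0 'k"
    by (rule flinearI)
      (simp_all add: tensor_alt lin_ext_add lin_ext_add_fun lin_ext_scale lin_ext_scale_fun)
  moreover have "flinear (\<lambda>x. x \<otimes> y)" for y :: "'b \<Rightarrow>\<^sub>0 'k"
    unfolding tensor_alt by (rule flinear_lin_ext)
  ultimately show ?thesis by (auto simp: bilin_def)
qed

lemma flinear_tensor_lift: "flinear (tensor_lift f)"
  unfolding tensor_lift_def by (rule flinear_lin_ext)

lemma tensor_lift_tensor:
  assumes "bilin f"
  shows "tensor_lift f (x \<otimes> y) = f x y"
proof -
  interpret T: Vector_Spaces.linear fscale fscale "tensor_lift f" by (rule flinear_tensor_lift)
  have l: "flinear (f u)" "flinear (\<lambda>x. f x v)" for u v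
    using assms by (auto simp: bilin_def)
  have "tensor_lift f (x \<otimes> y) =
      (\<Sum>a\<in>Poly_Mapping.keys x. \<Sum>b\<in>Poly_Mapping.keys y. Poly_Mapping.lookup x a *\<^sub>K Poly_Mapping.lookup y b *\<^sub>K tensor_lift f (basis_vec (a, b)))"
    unfolding tensor_alt lin_ext_def by (simp add: T.sum T.scale free.scale_sum_right)
  also have "\<dots> = (\<Sum>a\<in>Poly_Mapping.keys x. Poly_Mapping.lookup x a *\<^sub>K (\<Sum>b\<in>Poly_Mapping.keys y. Poly_Mapping.lookup y b *\<^sub>K f (basis_vec a) (basis_vec b)))"
    by (simp add: tensor_lift_def free.scale_sum_right)
  also have "\<dots> = (\<Sum>a\<in>Poly_Mapping.keys x. Poly_Mapping.lookup x a *\<^sub>K f (basis_vec a) y)"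
    by (subst flinear_expand[OF l(1), of _ y]) simp
  also have "\<dots> = f x y"
    by (subst flinear_expand[OF l(2), of x y]) simp
  finally show ?thesis .
qed

lemma tensor_lift_unique:
  assumes "flinear g" "\<And>x y. g (x \<otimes> y) = f x y"
  shows "g = tensor_lift f"
proof
  fix u
  have "g (basis_vec p) = tensor_lift f (basis_vec p)" for p
    using assms(2)[of "basis_vec (fst p)" "basis_vec (snd p)"]
    by (simp add: tensor_lift_def case_prod_beta)
  then show "g u = tensor_lift f u"
    by (simp add: flinear_expand[OF assms(1), of u] flinear_expand[OF flinear_tensor_lift, of f u])
qed

definition map_tensor ::
    "(('a \<Rightarrow>\<^sub>0 'k) \<Rightarrow> ('c \<Rightarrow>\<^sub>0 'k)) \<Rightarrow> (('b \<Rightarrow>\<^sub>0 'k) \<Rightarrow> ('d \<Rightarrow>\<^sub>0 'k)) \<Rightarrow>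
      ('a \<times> 'b \<Rightarrow>\<^sub>0 'k) \<Rightarrow> ('c \<times> 'd \<Rightarrow>\<^sub>0 'k::field)"
  where "map_tensor f g = tensor_lift (\<lambda>x y. f x \<otimes> g y)"

definition tensor_assoc :: "(('a \<times> 'b) \<times> 'c \<Rightarrow>\<^sub>0 'k) \<Rightarrow> ('a \<times> 'b \<times> 'c \<Rightarrow>\<^sub>0 'k::field)"
  where "tensor_assoc = tensor_lift (\<lambda>u z. tensor_lift (\<lambda>x y. x \<otimes> y \<otimes> z) u)"

definition tensor_mult ::
    "(('b \<Rightarrow>\<^sub>0 'k) \<Rightarrow> ('b \<Rightarrow>\<^sub>0 'k) \<Rightarrow> ('b \<Rightarrow>\<^sub>0 'k)) \<Rightarrow>
      ('b \<times> 'b \<Rightarrow>\<^sub>0 'k) \<Rightarrow> ('b \<times> 'b \<Rightarrow>\<^sub>0 'k) \<Rightarrow> ('b \<times> 'b \<Rightarrow>\<^sub>0 'k::field)"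
  where "tensor_mult m u v = tensor_lift (\<lambda>a b. tensor_lift (\<lambda>c d. m a c \<otimes> m b d) v) u"


section \<open>Hopf algebras and infinitesimal Hopf algebras\<close>

locale unital_algebra =
  fixes m :: "('b \<Rightarrow>\<^sub>0 'k::field) \<Rightarrow> ('b \<Rightarrow>\<^sub>0 'k) \<Rightarrow> ('b \<Rightarrow>\<^sub>0 'k)"
    and e :: "'b \<Rightarrow>\<^sub>0 'k"
  assumes mult_bilin: "bilin m"
    and mult_assoc: "m (m x y) z = m x (m y z)"
    and mult_unit_left: "m e x = x"
    and mult_unit_right: "m x e = x"

locale counital_coalgebra =
  fixes \<Delta> :: "('b \<Rightarrow>\<^sub>0 'k::field) \<Rightarrow> ('b \<times> 'b \<Rightarrow>\<^sub>0 'k)"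
    and \<epsilon> :: "('b \<Rightarrow>\<^sub>0 'k) \<Rightarrow> 'k"
  assumes comult_linear: "flinear \<Delta>"
    and counit_linear: "Vector_Spaces.linear fscale (*) \<epsilon>"
    and comult_coassoc: "tensor_assoc (map_tensor \<Delta> id (\<Delta> x)) = map_tensor id \<Delta> (\<Delta> x)"
    and counit_left: "tensor_lift (\<lambda>x y. \<epsilon> x *\<^sub>K y) (\<Delta> x) = x"
    and counit_right: "tensor_lift (\<lambda>x y. \<epsilon> y *\<^sub>K x) (\<Delta> x) = x"

locale bialgebra = unital_algebra m e + counital_coalgebra \<Delta> \<epsilon>
  for m :: "('b \<Rightarrow>\<^sub>0 'k::field) \<Rightarrow> ('b \<Rightarrow>\<^sub>0 'k) \<Rightarrow> ('b \<Rightarrow>\<^sub>0 'k)" and e \<Delta> \<epsilon> +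
  assumes comult_mult: "\<Delta> (m x y) = tensor_mult m (\<Delta> x) (\<Delta> y)"
    and comult_unit: "\<Delta> e = e \<otimes> e"
    and counit_mult: "\<epsilon> (m x y) = \<epsilon> x * \<epsilon> y"
    and counit_unit: "\<epsilon> e = 1"

locale hopf_algebra = bialgebra m e \<Delta> \<epsilon>
  for m :: "('b \<Rightarrow>\<^sub>0 'k::field) \<Rightarrow> ('b \<Rightarrow>\<^sub>0 'k) \<Rightarrow> ('b \<Rightarrow>\<^sub>0 'k)" and e \<Delta> \<epsilon> +
  fixes S :: "('b \<Rightarrow>\<^sub>0 'k) \<Rightarrow> ('b \<Rightarrow>\<^sub>0 'k)"
  assumes antipode_linear: "flinear S"
    and antipode_left: "tensor_lift m (map_tensor S id (\<Delta> x)) = \<epsilon> x *\<^sub>K e"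
    and antipode_right: "tensor_lift m (map_tensor id S (\<Delta> x)) = \<epsilon> x *\<^sub>K e"

locale graded_space =
  fixes V :: "nat \<Rightarrow> ('b \<Rightarrow>\<^sub>0 'k::field) set"
  assumes subspace_component: "free.subspace (V n)"
    and direct_sum: "\<exists>!c. (\<forall>n. c n \<in> V n) \<and> finite {n. c n \<noteq> 0} \<and> x = (\<Sum>n | c n \<noteq> 0. c n)"

definition tensor_component :: "(nat \<Rightarrow> ('b \<Rightarrow>\<^sub>0 'k::field) set) \<Rightarrow> nat \<Rightarrow> ('b \<times> 'b \<Rightarrow>\<^sub>0 'k) set"
  where "tensor_component V n = free.span {x \<otimes> y | x y i j. x \<in> V i \<and> y \<in> V j \<and> i + j = n}"

text \<open>
  All structure maps are homogeneous of degree 0, the field being concentrated in degree 0.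
\<close>

locale grading = graded_space V
  for V :: "nat \<Rightarrow> ('b \<Rightarrow>\<^sub>0 'k::field) set" +
  fixes m :: "('b \<Rightarrow>\<^sub>0 'k) \<Rightarrow> ('b \<Rightarrow>\<^sub>0 'k) \<Rightarrow> ('b \<Rightarrow>\<^sub>0 'k)" and e \<Delta> \<epsilon>
  assumes unit_graded: "e \<in> V 0"
    and mult_graded: "x \<in> V i \<Longrightarrow> y \<in> V j \<Longrightarrow> m x y \<in> V (i + j)"
    and comult_graded: "x \<in> V n \<Longrightarrow> \<Delta> x \<in> tensor_component V n"
    and counit_graded: "x \<in> V n \<Longrightarrow> n \<noteq> 0 \<Longrightarrow> \<epsilon> x = (0::'k)"

locale graded_hopf_algebra = hopf_algebra m e \<Delta> \<epsilon> S + grading V m e \<Delta> \<epsilon>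
  for m :: "('b \<Rightarrow>\<^sub>0 'k::field) \<Rightarrow> ('b \<Rightarrow>\<^sub>0 'k) \<Rightarrow> ('b \<Rightarrow>\<^sub>0 'k)" and e \<Delta> \<epsilon> S V +
  assumes antipode_graded: "x \<in> V n \<Longrightarrow> S x \<in> V n"

locale infinitesimal_hopf_algebra =
  unital_algebra m e + counital_coalgebra \<Delta> \<epsilon> + grading V m e \<Delta> \<epsilon>
  for m :: "('b \<Rightarrow>\<^sub>0 'k::field) \<Rightarrow> ('b \<Rightarrow>\<^sub>0 'k) \<Rightarrow> ('b \<Rightarrow>\<^sub>0 'k)" and e \<Delta> \<epsilon> V +
  assumes comult_unit: "\<Delta> e = e \<otimes> e"
    and connected: "free.dim (V 0) = 1"
    and comult_mult:
      "\<Delta> (m x y) = tensor_mult m (x \<otimes> e) (\<Delta> y) + tensor_mult m (\<Delta> x) (e \<otimes> y) - x \<otimes> y"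


section \<open>Double posets\<close>

record 'a dposet =
  points :: "'a set"
  le1 :: "'a rel"
  le2 :: "'a rel"

definition double_poset :: "'a dposet \<Rightarrow> bool"
  where "double_poset P \<longleftrightarrow>
    finite (points P) \<and> partial_order_on (points P) (le1 P) \<and> partial_order_on (points P) (le2 P)"

definition is_dposet_iso :: "('a \<Rightarrow> 'b) \<Rightarrow> 'a dposet \<Rightarrow> 'b dposet \<Rightarrow> bool"
  where "is_dposet_iso f P Q \<longleftrightarrow> bij_betw f (points P) (points Q) \<and>
    (\<forall>x\<in>points P. \<forall>y\<in>points P.
      ((x, y) \<in> le1 P \<longleftrightarrow> (f x, f y) \<in> le1 Q) \<and> ((x, y) \<in> le2 P \<longleftrightarrow> (f x, f y) \<in> le2 Q))"

definition dposet_iso :: "'a dposet \<Rightarrow> 'b dposet \<Rightarrow> bool"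
  where "dposet_iso P Q \<longleftrightarrow> (\<exists>f. is_dposet_iso f P Q)"

definition sub_dposet :: "'a dposet \<Rightarrow> 'a set \<Rightarrow> 'a dposet"
  where "sub_dposet P A = \<lparr>points = A, le1 = le1 P \<inter> A \<times> A, le2 = le2 P \<inter> A \<times> A\<rparr>"

definition ideals :: "'a dposet \<Rightarrow> 'a set set"
  where "ideals P = {I. I \<subseteq> points P \<and> (\<forall>x\<in>I. \<forall>y\<in>points P. (x, y) \<in> le1 P \<longrightarrow> y \<in> I)}"

definition empty_dposet :: "'a dposet"
  where "empty_dposet = \<lparr>points = {}, le1 = {}, le2 = {}\<rparr>"

definition disj_rel :: "'a rel \<Rightarrow> 'b rel \<Rightarrow> ('a + 'b) rel"
  where "disj_rel r s = map_prod Inl Inl ` r \<union> map_prod Inr Inr ` s"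

definition dposet_leadsto :: "'a dposet \<Rightarrow> 'b dposet \<Rightarrow> ('a + 'b) dposet"
  where "dposet_leadsto P Q =
    \<lparr>points = points P <+> points Q,
     le1 = disj_rel (le1 P) (le1 Q),
     le2 = disj_rel (le2 P) (le2 Q) \<union> (Inl ` points P) \<times> (Inr ` points Q)\<rparr>"

definition dposet_natural :: "'a dposet \<Rightarrow> 'b dposet \<Rightarrow> ('a + 'b) dposet"
  where "dposet_natural P Q =
    \<lparr>points = points P <+> points Q,
     le1 = disj_rel (le1 P) (le1 Q) \<union> (Inl ` points P) \<times> (Inr ` points Q),
     le2 = disj_rel (le2 P) (le2 Q)\<rparr>"

lemma double_posetD:
  assumes "double_poset P"
  shows "finite (points P)" "le1 P \<subseteq> points P \<times> points P" "le2 P \<subseteq> points P \<times> points P"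
    "refl_on (points P) (le1 P)" "refl_on (points P) (le2 P)"
    "trans (le1 P)" "trans (le2 P)" "antisym (le1 P)" "antisym (le2 P)"
  using assms by (auto simp: double_poset_def partial_order_on_def preorder_on_def)

lemma is_dposet_iso_inv:
  assumes "is_dposet_iso f P Q"
  shows "is_dposet_iso (inv_into (points P) f) Q P"
proof -
  let ?g = "inv_into (points P) f"
  have f: "bij_betw f (points P) (points Q)" using assms by (simp add: is_dposet_iso_def)
  have g: "bij_betw ?g (points Q) (points P)" using f by (rule bij_betw_inv_into)
  have "?g x \<in> points P" "f (?g x) = x" if "x \<in> points Q" for x
    using that f g by (auto simp: bij_betw_def f_inv_into_f)
  then show ?thesis using assms g by (simp add: is_dposet_iso_def)
qed

lemma is_dposet_iso_comp:
  assumes "is_dposet_iso f P Q" "is_dposet_iso g Q R"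
  shows "is_dposet_iso (g \<circ> f) P R"
proof -
  have "f x \<in> points Q" if "x \<in> points P" for x
    using assms that by (auto simp: is_dposet_iso_def bij_betw_def)
  then show ?thesis using assms by (auto simp: is_dposet_iso_def intro: bij_betw_trans)
qed

lemma dposet_iso_refl [simp]: "dposet_iso P P"
  unfolding dposet_iso_def by (rule exI[of _ id]) (simp add: is_dposet_iso_def)

lemma dposet_iso_sym: "dposet_iso P Q \<Longrightarrow> dposet_iso Q P"
  unfolding dposet_iso_def using is_dposet_iso_inv by blast

lemma dposet_iso_trans: "dposet_iso P Q \<Longrightarrow> dposet_iso Q R \<Longrightarrow> dposet_iso P R"
  unfolding dposet_iso_def using is_dposet_iso_comp by blast

text \<open>
  Every double poset is isomorphic to one whose points are natural numbers, so isomorphism classes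
  of these represent all isomorphism classes.
\<close>

quotient_type dp = "nat dposet" / partial: "\<lambda>P Q. double_poset P \<and> double_poset Q \<and> dposet_iso P Q"
proof (rule part_equivpI)
  show "\<exists>P :: nat dposet. double_poset P \<and> double_poset P \<and> dposet_iso P P"
    by (rule exI[of _ empty_dposet])
      (simp add: double_poset_def empty_dposet_def partial_order_on_def preorder_on_def refl_on_def)
qed (auto simp: symp_def transp_def intro: dposet_iso_sym dposet_iso_trans)

text \<open>\<open>dp_class\<close> applies to double posets on any type, such as the sum types used for disjoint unions.\<close>

definition dp_class :: "'a dposet \<Rightarrow> dp"
  where "dp_class P = abs_dp (SOME Q. double_poset Q \<and> dposet_iso P Q)"

lemma nat_copy_exists:
  assumes "double_poset P"
  shows "\<exists>Q :: nat dposet. double_poset Q \<and> dposet_iso P Q"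
proof -
  note P = double_posetD[OF assms]
  obtain f :: "'a \<Rightarrow> nat" where f: "inj_on f (points P)"
    using finite_imp_inj_to_nat_seg[OF P(1)] by blast
  define Q where "Q = \<lparr>points = f ` points P, le1 = map_prod f f ` le1 P, le2 = map_prod f f ` le2 P\<rparr>"
  have po: "partial_order_on (f ` points P) (map_prod f f ` r)"
    if "partial_order_on (points P) r" for r
  proof -
    have r: "r \<subseteq> points P \<times> points P" "refl_on (points P) r" "trans r" "antisym r"
      using that by (auto simp: partial_order_on_def preorder_on_def)
    have "trans (map_prod f f ` r)"
    proof (rule transI)
      fix x y z assume "(x, y) \<in> map_prod f f ` r" "(y, z) \<in> map_prod f f ` r"
      then obtain a b c d where h: "(a, b) \<in> r" "(c, d) \<in> r" "x = f a" "y = f b" "y = f c" "z = f d"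
        by auto
      then have "b = c" using f r(1) by (auto dest: inj_onD)
      then show "(x, z) \<in> map_prod f f ` r" using h r(3) by (auto dest: transD)
    qed
    moreover have "antisym (map_prod f f ` r)"
    proof (rule antisymI)
      fix x y assume "(x, y) \<in> map_prod f f ` r" "(y, x) \<in> map_prod f f ` r"
      then obtain a b c d where h: "(a, b) \<in> r" "(c, d) \<in> r" "x = f a" "y = f b" "y = f c" "x = f d"
        by auto
      then have "b = c" "a = d" using f r(1) by (auto dest: inj_onD)
      then show "x = y" using h r(4) by (auto dest: antisymD)
    qed
    ultimately show ?thesis using r(1,2)
      by (auto simp: partial_order_on_def preorder_on_def refl_on_def)
  qed
  have "double_poset Q" using assms po by (simp add: double_poset_def Q_def)
  moreover have "((x, y) \<in> r) = ((f x, f y) \<in> map_prod f f ` r)"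
    if "r \<subseteq> points P \<times> points P" "x \<in> points P" "y \<in> points P" for r x y
  proof
    assume "(f x, f y) \<in> map_prod f f ` r"
    then obtain a b where "(a, b) \<in> r" "f x = f a" "f y = f b" by auto
    moreover from this have "x = a" "y = b"
      using that by (auto intro!: inj_onD[OF f])
    ultimately show "(x, y) \<in> r" by simp
  qed force
  then have "is_dposet_iso f P Q"
    using f P(2,3) by (simp add: is_dposet_iso_def Q_def bij_betw_def)
  ultimately show ?thesis unfolding dposet_iso_def by blast
qed

lemma dp_class_eq_iff:
  assumes "double_poset P" "double_poset Q"
  shows "dp_class P = dp_class Q \<longleftrightarrow> dposet_iso P Q"
proof -
  define P' :: "nat dposet" where "P' = (SOME R. double_poset R \<and> dposet_iso P R)"
  define Q' :: "nat dposet" where "Q' = (SOME R. double_poset R \<and> dposet_iso Q R)"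
  have P': "double_poset P'" "dposet_iso P P'"
    using someI_ex[OF nat_copy_exists[OF assms(1)]] by (auto simp: P'_def)
  have Q': "double_poset Q'" "dposet_iso Q Q'"
    using someI_ex[OF nat_copy_exists[OF assms(2)]] by (auto simp: Q'_def)
  have "dp_class P = dp_class Q \<longleftrightarrow> abs_dp P' = abs_dp Q'"
    by (simp add: dp_class_def P'_def Q'_def)
  also have "\<dots> \<longleftrightarrow> dposet_iso P' Q'"
    using Quotient3_rel[OF Quotient3_dp, of P' Q'] P' Q' by simp
  also have "\<dots> \<longleftrightarrow> dposet_iso P Q"
    using P' Q' by (meson dposet_iso_sym dposet_iso_trans)
  finally show ?thesis .
qed

lemma double_poset_rep [simp]: "double_poset (rep_dp p)"
  using Quotient3_rep_reflp[OF Quotient3_dp, of p] by simp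

lemma dp_class_rep [simp]: "dp_class (rep_dp p) = p"
proof -
  define R :: "nat dposet" where "R = (SOME R. double_poset R \<and> dposet_iso (rep_dp p) R)"
  have "double_poset R" "dposet_iso (rep_dp p) R"
    using someI_ex[OF nat_copy_exists[OF double_poset_rep[of p]]] by (auto simp: R_def)
  then have "abs_dp R = abs_dp (rep_dp p)"
    using Quotient3_rel[OF Quotient3_dp, of R "rep_dp p"] dposet_iso_sym by auto
  then show ?thesis
    by (simp add: dp_class_def R_def Quotient3_abs_rep[OF Quotient3_dp])
qed

lemma rep_dp_class:
  assumes "double_poset P"
  shows "dposet_iso (rep_dp (dp_class P)) P"
  by (rule iffD1[OF dp_class_eq_iff[OF double_poset_rep assms] dp_class_rep])


section \<open>The space of double posets\<close>

definition dp_leadsto :: "dp \<Rightarrow> dp \<Rightarrow> dp"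
  where "dp_leadsto p q = dp_class (dposet_leadsto (rep_dp p) (rep_dp q))"

definition dp_natural :: "dp \<Rightarrow> dp \<Rightarrow> dp"
  where "dp_natural p q = dp_class (dposet_natural (rep_dp p) (rep_dp q))"

definition dp_size :: "dp \<Rightarrow> nat"
  where "dp_size p = card (points (rep_dp p))"

definition dp_coproduct :: "dp \<Rightarrow> (dp \<times> dp \<Rightarrow>\<^sub>0 'k::field)"
  where "dp_coproduct p = (let P = rep_dp p in
    \<Sum>I\<in>ideals P. basis_vec (dp_class (sub_dposet P (points P - I))) \<otimes> basis_vec (dp_class (sub_dposet P I)))"

definition H_one :: "dp \<Rightarrow>\<^sub>0 'k::field"
  where "H_one = basis_vec (dp_class (empty_dposet :: nat dposet))"

definition H_leadsto :: "(dp \<Rightarrow>\<^sub>0 'k::field) \<Rightarrow> (dp \<Rightarrow>\<^sub>0 'k) \<Rightarrow> (dp \<Rightarrow>\<^sub>0 'k)"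
  where "H_leadsto x y = lin_ext (\<lambda>p. lin_ext (\<lambda>q. basis_vec (dp_leadsto p q)) y) x"

definition H_natural :: "(dp \<Rightarrow>\<^sub>0 'k::field) \<Rightarrow> (dp \<Rightarrow>\<^sub>0 'k) \<Rightarrow> (dp \<Rightarrow>\<^sub>0 'k)"
  where "H_natural x y = lin_ext (\<lambda>p. lin_ext (\<lambda>q. basis_vec (dp_natural p q)) y) x"

definition H_coproduct :: "(dp \<Rightarrow>\<^sub>0 'k::field) \<Rightarrow> (dp \<times> dp \<Rightarrow>\<^sub>0 'k)"
  where "H_coproduct = lin_ext dp_coproduct"

definition H_component :: "nat \<Rightarrow> (dp \<Rightarrow>\<^sub>0 'k::field) set"
  where "H_component n = free.span {basis_vec p | p. dp_size p = n}"

text \<open>The definitions above do not depend on the chosen representatives.\<close>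

lemma double_poset_sub:
  assumes "double_poset P" "A \<subseteq> points P"
  shows "double_poset (sub_dposet P A)"
proof -
  have "partial_order_on A (r \<inter> A \<times> A)" if "partial_order_on (points P) r" for r
    using that assms(2)
    by (auto simp: partial_order_on_def preorder_on_def refl_on_def antisym_def intro!: transI dest: transD)
  then show ?thesis
    using assms by (auto simp: double_poset_def sub_dposet_def intro: finite_subset)
qed

lemma dposet_iso_sub:
  assumes "is_dposet_iso f P Q" "A \<subseteq> points P"
  shows "dposet_iso (sub_dposet P A) (sub_dposet Q (f ` A))"
proof -
  have "inj_on f (points P)" using assms(1) by (simp add: is_dposet_iso_def bij_betw_def)
  then have "bij_betw f A (f ` A)" using assms(2) by (auto simp: bij_betw_def intro: inj_on_subset)
  moreover have "((x, y) \<in> le1 P \<longleftrightarrow> (f x, f y) \<in> le1 Q) \<and> ((x, y) \<in> le2 P \<longleftrightarrow> (f x, f y) \<in> le2 Q)"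
    if "x \<in> A" "y \<in> A" for x y
    using assms that unfolding is_dposet_iso_def by blast
  ultimately have "is_dposet_iso f (sub_dposet P A) (sub_dposet Q (f ` A))"
    unfolding is_dposet_iso_def sub_dposet_def by auto
  then show ?thesis unfolding dposet_iso_def by blast
qed

lemma disj_rel_mem:
  "(Inl a, Inl a') \<in> disj_rel r s \<longleftrightarrow> (a, a') \<in> r"
  "(Inr b, Inr b') \<in> disj_rel r s \<longleftrightarrow> (b, b') \<in> s"
  "(Inl a, Inr b) \<notin> disj_rel r s" "(Inr b, Inl a) \<notin> disj_rel r s"
  by (force simp: disj_rel_def)+

lemma double_poset_disj:
  assumes "partial_order_on A r" "partial_order_on B s"
  shows "partial_order_on (A <+> B) (disj_rel r s)"
    and "partial_order_on (A <+> B) (disj_rel r s \<union> (Inl ` A) \<times> (Inr ` B))"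
proof -
  have rs: "r \<subseteq> A \<times> A" "refl_on A r" "trans r" "antisym r" "s \<subseteq> B \<times> B" "refl_on B s" "trans s" "antisym s"
    using assms by (auto simp: partial_order_on_def preorder_on_def)
  have sub: "disj_rel r s \<subseteq> (A <+> B) \<times> (A <+> B)"
    using rs by (auto simp: disj_rel_def)
  have refl: "refl_on (A <+> B) (disj_rel r s)"
    using rs by (force simp: disj_rel_def refl_on_def)
  have "trans (disj_rel r s)"
  proof (rule transI)
    fix x y z assume "(x, y) \<in> disj_rel r s" "(y, z) \<in> disj_rel r s"
    then show "(x, z) \<in> disj_rel r s"
      using rs by (cases x; cases y; cases z) (auto simp: disj_rel_mem dest: transD)
  qed
  moreover have "antisym (disj_rel r s)"
  proof (rule antisymI)
    fix x y assume "(x, y) \<in> disj_rel r s" "(y, x) \<in> disj_rel r s"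
    then show "x = y"
      using rs by (cases x; cases y) (auto simp: disj_rel_mem dest: antisymD)
  qed
  ultimately show "partial_order_on (A <+> B) (disj_rel r s)"
    using sub refl by (simp add: partial_order_on_def preorder_on_def)
  let ?t = "disj_rel r s \<union> (Inl ` A) \<times> (Inr ` B)"
  have "trans ?t"
  proof (rule transI)
    fix x y z assume "(x, y) \<in> ?t" "(y, z) \<in> ?t"
    then show "(x, z) \<in> ?t"
      using rs by (cases x; cases y; cases z) (auto simp: disj_rel_mem dest: transD)
  qed
  moreover have "antisym ?t"
  proof (rule antisymI)
    fix x y assume "(x, y) \<in> ?t" "(y, x) \<in> ?t"
    then show "x = y"
      using rs by (cases x; cases y) (auto simp: disj_rel_mem dest: antisymD)
  qed
  ultimately show "partial_order_on (A <+> B) ?t"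
    using sub refl by (auto simp: partial_order_on_def preorder_on_def refl_on_def)
qed

lemma double_poset_leadsto: "double_poset P \<Longrightarrow> double_poset Q \<Longrightarrow> double_poset (dposet_leadsto P Q)"
  and double_poset_natural: "double_poset P \<Longrightarrow> double_poset Q \<Longrightarrow> double_poset (dposet_natural P Q)"
  by (simp_all add: double_poset_def dposet_leadsto_def dposet_natural_def double_poset_disj)

lemma dposet_iso_disj:
  assumes "dposet_iso P P'" "dposet_iso Q Q'"
  shows "dposet_iso (dposet_leadsto P Q) (dposet_leadsto P' Q')"
    and "dposet_iso (dposet_natural P Q) (dposet_natural P' Q')"
proof -
  obtain f g where f: "is_dposet_iso f P P'" and g: "is_dposet_iso g Q Q'"
    using assms by (auto simp: dposet_iso_def)
  have fm: "f x \<in> points P'" if "x \<in> points P" for x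
    using f that by (auto simp: is_dposet_iso_def bij_betw_def)
  have gm: "g x \<in> points Q'" if "x \<in> points Q" for x
    using g that by (auto simp: is_dposet_iso_def bij_betw_def)
  have fb: "inj_on f (points P)" "f ` points P = points P'"
    and gb: "inj_on g (points Q)" "g ` points Q = points Q'"
    using f g by (auto simp: is_dposet_iso_def bij_betw_def)
  have "inj_on (map_sum f g) (points P <+> points Q)"
  proof (rule inj_onI)
    fix x y assume "x \<in> points P <+> points Q" "y \<in> points P <+> points Q" "map_sum f g x = map_sum f g y"
    then show "x = y"
      by (cases x; cases y) (auto dest: inj_onD[OF fb(1)] inj_onD[OF gb(1)])
  qed
  moreover have "map_sum f g ` (points P <+> points Q) = points P' <+> points Q'"
    unfolding Plus_def fb(2)[symmetric] gb(2)[symmetric] by (simp add: image_Un image_image)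
  ultimately have bij: "bij_betw (map_sum f g) (points P <+> points Q) (points P' <+> points Q')"
    by (simp add: bij_betw_def)
  have rel: "(map_sum f g x, map_sum f g y) \<in> disj_rel r' s' \<longleftrightarrow> (x, y) \<in> disj_rel r s"
    if "x \<in> points P <+> points Q" "y \<in> points P <+> points Q"
      "\<forall>x\<in>points P. \<forall>y\<in>points P. (x, y) \<in> r \<longleftrightarrow> (f x, f y) \<in> r'"
      "\<forall>x\<in>points Q. \<forall>y\<in>points Q. (x, y) \<in> s \<longleftrightarrow> (g x, g y) \<in> s'" for x y r s r' s'
    using that by (cases x; cases y) (auto simp: disj_rel_mem)
  have cross: "(map_sum f g x, map_sum f g y) \<in> (Inl ` points P') \<times> (Inr ` points Q') \<longleftrightarrow>
      (x, y) \<in> (Inl ` points P) \<times> (Inr ` points Q)"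
    if "x \<in> points P <+> points Q" "y \<in> points P <+> points Q" for x y
    using that fm gm by (cases x; cases y) auto
  have iso1: "\<forall>x\<in>points P. \<forall>y\<in>points P. (x, y) \<in> le1 P \<longleftrightarrow> (f x, f y) \<in> le1 P'"
    "\<forall>x\<in>points P. \<forall>y\<in>points P. (x, y) \<in> le2 P \<longleftrightarrow> (f x, f y) \<in> le2 P'"
    "\<forall>x\<in>points Q. \<forall>y\<in>points Q. (x, y) \<in> le1 Q \<longleftrightarrow> (g x, g y) \<in> le1 Q'"
    "\<forall>x\<in>points Q. \<forall>y\<in>points Q. (x, y) \<in> le2 Q \<longleftrightarrow> (g x, g y) \<in> le2 Q'"
    using f g by (auto simp: is_dposet_iso_def)
  have "is_dposet_iso (map_sum f g) (dposet_leadsto P Q) (dposet_leadsto P' Q')"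
    unfolding is_dposet_iso_def dposet_leadsto_def dposet.simps Un_iff
  proof (intro conjI ballI bij)
    fix x y assume xy: "x \<in> points P <+> points Q" "y \<in> points P <+> points Q"
    note rw = rel[OF xy iso1(1,3)] rel[OF xy iso1(2,4)] cross[OF xy]
    show "((x, y) \<in> disj_rel (le1 P) (le1 Q)) = ((map_sum f g x, map_sum f g y) \<in> disj_rel (le1 P') (le1 Q'))"
      by (simp only: rw)
    show "((x, y) \<in> disj_rel (le2 P) (le2 Q) \<or> (x, y) \<in> (Inl ` points P) \<times> (Inr ` points Q)) =
      ((map_sum f g x, map_sum f g y) \<in> disj_rel (le2 P') (le2 Q') \<or>
       (map_sum f g x, map_sum f g y) \<in> (Inl ` points P') \<times> (Inr ` points Q'))"
      by (simp only: rw)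
  qed
  moreover have "is_dposet_iso (map_sum f g) (dposet_natural P Q) (dposet_natural P' Q')"
    unfolding is_dposet_iso_def dposet_natural_def dposet.simps Un_iff
  proof (intro conjI ballI bij)
    fix x y assume xy: "x \<in> points P <+> points Q" "y \<in> points P <+> points Q"
    note rw = rel[OF xy iso1(1,3)] rel[OF xy iso1(2,4)] cross[OF xy]
    show "((x, y) \<in> disj_rel (le1 P) (le1 Q) \<or> (x, y) \<in> (Inl ` points P) \<times> (Inr ` points Q)) =
      ((map_sum f g x, map_sum f g y) \<in> disj_rel (le1 P') (le1 Q') \<or>
       (map_sum f g x, map_sum f g y) \<in> (Inl ` points P') \<times> (Inr ` points Q'))"
      by (simp only: rw)
    show "((x, y) \<in> disj_rel (le2 P) (le2 Q)) = ((map_sum f g x, map_sum f g y) \<in> disj_rel (le2 P') (le2 Q'))"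
      by (simp only: rw)
  qed
  ultimately show "dposet_iso (dposet_leadsto P Q) (dposet_leadsto P' Q')"
    and "dposet_iso (dposet_natural P Q) (dposet_natural P' Q')"
    unfolding dposet_iso_def by blast+
qed

lemma dp_leadsto_class:
  assumes "double_poset P" "double_poset Q"
  shows "dp_leadsto (dp_class P) (dp_class Q) = dp_class (dposet_leadsto P Q)"
  using assms
  by (simp add: dp_leadsto_def dp_class_eq_iff double_poset_leadsto dposet_iso_disj rep_dp_class)

lemma dp_natural_class:
  assumes "double_poset P" "double_poset Q"
  shows "dp_natural (dp_class P) (dp_class Q) = dp_class (dposet_natural P Q)"
  using assms
  by (simp add: dp_natural_def dp_class_eq_iff double_poset_natural dposet_iso_disj rep_dp_class)

lemma dp_size_class:
  assumes "double_poset P"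
  shows "dp_size (dp_class P) = card (points P)"
  using rep_dp_class[OF assms]
  by (auto simp: dp_size_def dposet_iso_def is_dposet_iso_def dest: bij_betw_same_card)

lemma ideals_iso:
  assumes "is_dposet_iso f P Q" "I \<in> ideals P"
  shows "f ` I \<in> ideals Q"
proof -
  have f: "f ` points P = points Q" using assms(1) by (simp add: is_dposet_iso_def bij_betw_def)
  have I: "I \<subseteq> points P" using assms(2) by (simp add: ideals_def)
  have "y \<in> f ` I" if xy: "x \<in> f ` I" "y \<in> points Q" "(x, y) \<in> le1 Q" for x y
  proof -
    obtain a b where "a \<in> I" "b \<in> points P" "x = f a" "y = f b" using xy f by blast
    moreover from this have "(a, b) \<in> le1 P"
      using assms(1) I xy unfolding is_dposet_iso_def by blast
    ultimately show ?thesis using assms(2) by (auto simp: ideals_def)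
  qed
  moreover have "f ` I \<subseteq> points Q" using I f by blast
  ultimately show ?thesis by (auto simp: ideals_def)
qed

lemma bij_betw_ideals:
  assumes "is_dposet_iso f P Q"
  shows "bij_betw ((`) f) (ideals P) (ideals Q)"
proof -
  have inj: "inj_on f (points P)" and img: "f ` points P = points Q"
    using assms by (auto simp: is_dposet_iso_def bij_betw_def)
  let ?g = "inv_into (points P) f"
  have g: "is_dposet_iso ?g Q P" by (rule is_dposet_iso_inv[OF assms])
  show ?thesis
  proof (rule bij_betw_byWitness[where f' = "(`) ?g"])
    show "\<forall>I\<in>ideals P. ?g ` f ` I = I"
      using inj by (auto simp: ideals_def inv_into_image_cancel)
    show "\<forall>J\<in>ideals Q. f ` ?g ` J = J"
      using img by (auto simp: ideals_def image_inv_into_cancel)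
  qed (use ideals_iso[OF assms] ideals_iso[OF g] in auto)
qed

lemma dp_coproduct_class:
  assumes "double_poset P"
  shows "(dp_coproduct (dp_class P) :: _ \<Rightarrow>\<^sub>0 'k::field) =
    (\<Sum>I\<in>ideals P. basis_vec (dp_class (sub_dposet P (points P - I))) \<otimes> basis_vec (dp_class (sub_dposet P I)))"
proof -
  let ?R = "rep_dp (dp_class P)"
  obtain f where f: "is_dposet_iso f P ?R"
    using rep_dp_class[OF assms] dposet_iso_sym by (auto simp: dposet_iso_def)
  have inj: "inj_on f (points P)" and img: "f ` points P = points ?R"
    using f by (auto simp: is_dposet_iso_def bij_betw_def)
  have cls: "dp_class (sub_dposet ?R (f ` A)) = dp_class (sub_dposet P A)" if "A \<subseteq> points P" for A
  proof -
    have "f ` A \<subseteq> points ?R" using that img by blast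
    then show ?thesis
      using that assms dposet_iso_sym[OF dposet_iso_sub[OF f that]]
      by (simp add: dp_class_eq_iff double_poset_sub)
  qed
  have diff: "points ?R - f ` I = f ` (points P - I)" if "I \<subseteq> points P" for I
    using that inj img by (simp add: inj_on_image_set_diff flip: img)
  have "(dp_coproduct (dp_class P) :: _ \<Rightarrow>\<^sub>0 'k) =
    (\<Sum>I\<in>ideals P. basis_vec (dp_class (sub_dposet ?R (points ?R - f ` I))) \<otimes>
      basis_vec (dp_class (sub_dposet ?R (f ` I))))"
    unfolding dp_coproduct_def Let_def by (rule sum.reindex_bij_betw[OF bij_betw_ideals[OF f], symmetric])
  also have "\<dots> = (\<Sum>I\<in>ideals P. basis_vec (dp_class (sub_dposet P (points P - I))) \<otimes>
      basis_vec (dp_class (sub_dposet P I)))"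
    by (intro sum.cong refl) (simp add: ideals_def diff cls)
  finally show ?thesis .
qed

end

theory Submission
  imports Defs
begin

text \<open>
  All structure maps are determined by their values on basis vectors, so each axiom is a combinatorial
  statement about isomorphism classes and about the terms \<open>(P \ I) \<otimes> I\<close> of the coproduct, one for each
  ideal \<open>I\<close> of a double poset \<open>P\<close>.

  Coassociativity holds because both iterated coproducts sum over the chains \<open>I \<subseteq> J\<close> of ideals of \<open>P\<close>,
  with term \<open>(P \ J) \<otimes> (J \ I) \<otimes> I\<close>: an ideal of the ideal \<open>J\<close> is an ideal of \<open>P\<close> inside \<open>J\<close>, and
  the ideals of \<open>P \ I\<close> are the sets \<open>J \ I\<close> for the ideals \<open>J \<supseteq> I\<close> of \<open>P\<close> (\<open>dp_coproduct_coassoc\<close>). The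
  counit is the coefficient of the empty double poset.

  The two compatibility rules come from the ideals of the two products. For \<open>\<leadsto>\<close> the two parts are
  incomparable for the first order, so an ideal is an arbitrary pair of ideals and \<open>\<Delta>\<close> is
  multiplicative (\<open>dp_coproduct_leadsto\<close>). For \<open>\<natural>\<close> every element of the left part lies below every
  element of the right part for the first order, so an ideal either avoids the left part or contains
  the whole right part. The two families give the two products in the infinitesimal rule; their only
  common member is the right part itself, whose term \<open>P \<otimes> Q\<close> has to be subtracted
  (\<open>dp_coproduct_natural\<close>).

  The antipode comes from a general fact: a connected graded bialgebra is a graded Hopf algebra
  (\<open>connected_bialgebra.graded_hopf_algebra\<close>). The map \<open>\<eta>\<epsilon> - id\<close> kills degree \<open>0\<close>, so its convolution
  powers are locally nilpotent, and their sum is the convolution inverse of \<open>id = \<eta>\<epsilon> - (\<eta>\<epsilon> - id)\<close>.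
\<close>

section \<open>Linear and bilinear maps on free vector spaces\<close>

lemma flinear_add: "flinear f \<Longrightarrow> f (x + y) = f x + f y"
  and flinear_scale: "flinear f \<Longrightarrow> f (c *\<^sub>K x) = c *\<^sub>K f x"
  by (simp_all add: Vector_Spaces.linear_def module_hom_def module_hom_axioms_def)

lemma flinear_sum: "flinear f \<Longrightarrow> f (sum g A) = (\<Sum>i\<in>A. f (g i))"
proof -
  assume "flinear f"
  then interpret f: Vector_Spaces.linear fscale fscale f .
  show ?thesis by (rule f.sum)
qed

lemma flinear_diff: "flinear f \<Longrightarrow> f (x - y) = f x - f y"
proof -
  assume "flinear f"
  then interpret f: Vector_Spaces.linear fscale fscale f .
  show ?thesis by (rule f.diff)
qed

lemma flinear_zero: "flinear f \<Longrightarrow> f 0 = 0"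
  using flinear_diff[of f 0 0] by simp

lemma flinear_id: "flinear (\<lambda>x. x)"
  by (rule flinearI) auto

lemma flinear_compose: "flinear f \<Longrightarrow> flinear g \<Longrightarrow> flinear (\<lambda>x. f (g x))"
  by (rule flinearI) (simp_all add: flinear_add flinear_scale)

lemma flinear_add_fun: "flinear f \<Longrightarrow> flinear g \<Longrightarrow> flinear (\<lambda>x. f x + g x)"
  by (rule flinearI) (simp_all add: flinear_add flinear_scale free.scale_right_distrib)

lemma flinear_diff_fun: "flinear f \<Longrightarrow> flinear g \<Longrightarrow> flinear (\<lambda>x. f x - g x)"
  by (rule flinearI) (simp_all add: flinear_add flinear_scale free.scale_right_diff_distrib)

lemma flinear_lin_ext_eq: "flinear f \<Longrightarrow> f x = lin_ext (\<lambda>b. f (basis_vec b)) x"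
  by (simp add: lin_ext_def flip: flinear_expand)

lemma flinear_eqI:
  assumes "flinear f" "flinear g" "\<And>b. f (basis_vec b) = g (basis_vec b)"
  shows "f = g"
proof
  show "f x = g x" for x
    unfolding flinear_expand[OF assms(1), of x] flinear_expand[OF assms(2), of x] assms(3) ..
qed

text \<open>This rule and its instance \<open>lin_ext_lin_ext\<close> push every composite of structure maps into the form
  \<open>lin_ext F x\<close>, so that comparing two composites comes down to comparing them on basis vectors.\<close>

lemma flinear_of_lin_ext: "flinear f \<Longrightarrow> f (lin_ext g x) = lin_ext (\<lambda>b. f (g b)) x"
  by (simp add: lin_ext_def flinear_sum flinear_scale)

lemma lin_ext_lin_ext: "lin_ext f (lin_ext g x) = lin_ext (\<lambda>b. lin_ext f (g b)) x"
  by (rule flinear_of_lin_ext[OF flinear_lin_ext])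

lemma lin_ext_sum: "lin_ext f (sum g A) = (\<Sum>i\<in>A. lin_ext f (g i))"
  by (rule flinear_sum[OF flinear_lin_ext])

lemma lin_ext_basis_vec [simp]: "lin_ext basis_vec x = x"
  using free_expansion[of x] by (simp add: lin_ext_def)

lemma lin_ext_cong:
  "(\<And>b. b \<in> Poly_Mapping.keys x \<Longrightarrow> f b = g b) \<Longrightarrow> lin_ext f x = lin_ext g x"
  by (simp add: lin_ext_def)

lemma lin_ext_zero_fun: "lin_ext (\<lambda>b. 0) x = 0"
  by (simp add: lin_ext_def)

lemma lin_ext_sum_fun: "lin_ext (\<lambda>b. \<Sum>i\<in>A. f i b) x = (\<Sum>i\<in>A. lin_ext (f i) x)"
  unfolding lin_ext_def free.scale_sum_right by (rule sum.swap)

lemma lin_ext_diff_fun: "lin_ext (\<lambda>b. f b - g b) x = lin_ext f x - lin_ext g x"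
  by (simp add: lin_ext_def free.scale_right_diff_distrib sum_subtractf)

lemma keys_lin_ext: "Poly_Mapping.keys (lin_ext f x) \<subseteq> (\<Union>b\<in>Poly_Mapping.keys x. Poly_Mapping.keys (f b))"
proof
  fix c assume "c \<in> Poly_Mapping.keys (lin_ext f x)"
  then have "(\<Sum>b\<in>Poly_Mapping.keys x. Poly_Mapping.lookup x b * Poly_Mapping.lookup (f b) c) \<noteq> 0"
    by (simp add: lin_ext_def in_keys_iff lookup_sum)
  then obtain b where "b \<in> Poly_Mapping.keys x" "Poly_Mapping.lookup x b * Poly_Mapping.lookup (f b) c \<noteq> 0"
    by (rule sum.not_neutral_contains_not_neutral)
  then show "c \<in> (\<Union>b\<in>Poly_Mapping.keys x. Poly_Mapping.keys (f b))"
    by (auto simp: in_keys_iff)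
qed

lemma tensor_lift_eq: "tensor_lift f u = lin_ext (\<lambda>(a, b). f (basis_vec a) (basis_vec b)) u"
  by (simp add: tensor_lift_def)

lemma map_tensor_eq: "map_tensor f g u = lin_ext (\<lambda>(a, b). f (basis_vec a) \<otimes> g (basis_vec b)) u"
  by (simp add: map_tensor_def tensor_lift_def)

lemma tensor_assoc_eq: "tensor_assoc u = lin_ext (\<lambda>((a, b), c). basis_vec (a, b, c)) u"
  unfolding tensor_assoc_def tensor_lift_def
  by (intro arg_cong2[of _ _ _ _ lin_ext]) (auto simp: fun_eq_iff)

lemma tensor_mult_eq:
  "tensor_mult m u v = lin_ext (\<lambda>(a, b). lin_ext (\<lambda>(c, d).
     m (basis_vec a) (basis_vec c) \<otimes> m (basis_vec b) (basis_vec d)) v) u"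
  by (simp add: tensor_mult_def tensor_lift_def)

lemma bilin_flinear:
  assumes "bilin f"
  shows "flinear (f x)" and "flinear (\<lambda>x. f x y)"
  using assms by (auto simp: bilin_def)

lemma bilin_eqI:
  assumes "bilin f" "bilin g" "\<And>a b. f (basis_vec a) (basis_vec b) = g (basis_vec a) (basis_vec b)"
  shows "f x y = g x y"
proof -
  have expand: "h x y = lin_ext (\<lambda>a. lin_ext (\<lambda>b. h (basis_vec a) (basis_vec b)) y) x" if "bilin h" for h
    by (subst flinear_lin_ext_eq[OF bilin_flinear(2)[OF that]])
      (subst flinear_lin_ext_eq[OF bilin_flinear(1)[OF that], of _ y], rule refl)
  show ?thesis
    by (simp add: expand[OF assms(1)] expand[OF assms(2)] assms(3))
qed

lemma flinear_bilin: "flinear h \<Longrightarrow> bilin f \<Longrightarrow> bilin (\<lambda>x y. h (f x y))"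
  unfolding bilin_def by (auto intro: flinear_compose[of h])

lemma bilin_compose: "bilin f \<Longrightarrow> flinear g \<Longrightarrow> flinear h \<Longrightarrow> bilin (\<lambda>x y. f (g x) (h y))"
  unfolding bilin_def by (auto intro: flinear_compose[of "f _"] flinear_compose[of "\<lambda>x. f x _"])

lemma bilin_add: "bilin f \<Longrightarrow> bilin g \<Longrightarrow> bilin (\<lambda>x y. f x y + g x y)"
  and bilin_diff: "bilin f \<Longrightarrow> bilin g \<Longrightarrow> bilin (\<lambda>x y. f x y - g x y)"
  by (simp_all add: bilin_def flinear_add_fun flinear_diff_fun)

lemma bilin_lin_ext2: "bilin (\<lambda>x y. lin_ext (\<lambda>a. lin_ext (f a) y) x)"
proof -
  have "flinear (\<lambda>y. lin_ext (\<lambda>a. lin_ext (f a) y) x)" for x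
    by (rule flinearI) (simp_all add: lin_ext_add lin_ext_add_fun lin_ext_scale lin_ext_scale_fun)
  then show ?thesis
    unfolding bilin_def using flinear_lin_ext by blast
qed

lemma bilin_tensor_mult: "bilin (tensor_mult m)"
  using bilin_lin_ext2[of "\<lambda>(a, b) (c, d). m (basis_vec a) (basis_vec c) \<otimes> m (basis_vec b) (basis_vec d)"]
  by (simp add: tensor_mult_eq[abs_def] case_prod_beta')

section \<open>Gradings by a degree function on the basis\<close>

text \<open>With this description a homogeneity condition becomes an inclusion between sets of keys.\<close>

lemma span_basis_vec: "free.span (basis_vec ` A) = {x :: 'b \<Rightarrow>\<^sub>0 'k::field. Poly_Mapping.keys x \<subseteq> A}"
proof (intro equalityI subsetI)
  fix x :: "'b \<Rightarrow>\<^sub>0 'k"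
  assume "x \<in> free.span (basis_vec ` A)"
  moreover have "free.subspace {x :: 'b \<Rightarrow>\<^sub>0 'k. Poly_Mapping.keys x \<subseteq> A}"
  proof (rule free.subspaceI)
    show "x + y \<in> {x :: 'b \<Rightarrow>\<^sub>0 'k. Poly_Mapping.keys x \<subseteq> A}"
      if "x \<in> {x. Poly_Mapping.keys x \<subseteq> A}" "y \<in> {x. Poly_Mapping.keys x \<subseteq> A}" for x y
      using keys_add[of x y] that by auto
    show "c *\<^sub>K x \<in> {x :: 'b \<Rightarrow>\<^sub>0 'k. Poly_Mapping.keys x \<subseteq> A}"
      if "x \<in> {x. Poly_Mapping.keys x \<subseteq> A}" for c x
      using that by (auto simp: in_keys_iff)
  qed simp
  then have "free.span (basis_vec ` A) \<subseteq> {x :: 'b \<Rightarrow>\<^sub>0 'k. Poly_Mapping.keys x \<subseteq> A}"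
    by (intro free.span_minimal) auto
  ultimately show "x \<in> {x. Poly_Mapping.keys x \<subseteq> A}" by blast
next
  fix x :: "'b \<Rightarrow>\<^sub>0 'k"
  assume "x \<in> {x. Poly_Mapping.keys x \<subseteq> A}"
  then have "(\<Sum>b\<in>Poly_Mapping.keys x. Poly_Mapping.lookup x b *\<^sub>K basis_vec b) \<in> free.span (basis_vec ` A)"
    by (intro free.span_sum free.span_scale free.span_base) auto
  then show "x \<in> free.span (basis_vec ` A)"
    by (simp flip: free_expansion)
qed

definition homogeneous :: "('b \<Rightarrow> nat) \<Rightarrow> nat \<Rightarrow> ('b \<Rightarrow>\<^sub>0 'k::field) set"
  where "homogeneous deg n = free.span {basis_vec b | b. deg b = n}"

lemma homogeneous_keys: "homogeneous deg n = {x :: 'b \<Rightarrow>\<^sub>0 'k::field. Poly_Mapping.keys x \<subseteq> {b. deg b = n}}"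
proof -
  have "{basis_vec b | b. deg b = n} = (basis_vec :: 'b \<Rightarrow> 'b \<Rightarrow>\<^sub>0 'k) ` {b. deg b = n}" by auto
  then show ?thesis by (simp add: homogeneous_def span_basis_vec)
qed

lemma basis_vec_homogeneous: "basis_vec b \<in> homogeneous deg (deg b)"
  by (simp add: homogeneous_keys)

lemma subspace_homogeneous: "free.subspace (homogeneous deg n)"
  by (simp add: homogeneous_def)

lemma lin_ext_homogeneous:
  assumes "\<And>b. deg b = n \<Longrightarrow> f b \<in> homogeneous deg' k" "x \<in> homogeneous deg n"
  shows "lin_ext f x \<in> homogeneous deg' k"
  using assms keys_lin_ext[of f x] by (fastforce simp: homogeneous_keys)

text \<open>The component of degree \<open>n\<close> of \<open>x\<close> is its restriction to the basis vectors of degree \<open>n\<close>. It is forced: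
  a basis vector \<open>b\<close> can only occur in the component of degree \<open>deg b\<close>.\<close>

lemma graded_space_homogeneous: "graded_space (homogeneous deg :: nat \<Rightarrow> ('b \<Rightarrow>\<^sub>0 'k::field) set)"
proof
  fix x :: "'b \<Rightarrow>\<^sub>0 'k"
  define c where "c n = lin_ext (\<lambda>b. if deg b = n then basis_vec b else 0) x" for n
  have keys_c: "Poly_Mapping.keys (c n) \<subseteq> {b \<in> Poly_Mapping.keys x. deg b = n}" for n
    using keys_lin_ext[of "\<lambda>b. if deg b = n then basis_vec b else 0" x]
    unfolding c_def by (fastforce split: if_splits)
  have fin: "{n. c n \<noteq> 0} \<subseteq> deg ` Poly_Mapping.keys x"
    using keys_c by (fastforce simp flip: keys_eq_empty)
  have "(\<Sum>n | c n \<noteq> 0. c n) = (\<Sum>n\<in>deg ` Poly_Mapping.keys x. c n)"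
    using fin by (intro sum.mono_neutral_left) auto
  also have "\<dots> = lin_ext (\<lambda>b. \<Sum>n\<in>deg ` Poly_Mapping.keys x. if deg b = n then basis_vec b else 0) x"
    unfolding c_def by (rule lin_ext_sum_fun[symmetric])
  also have "\<dots> = lin_ext basis_vec x"
    by (rule lin_ext_cong) simp
  finally have sum_c: "x = (\<Sum>n | c n \<noteq> 0. c n)" by simp
  show "\<exists>!c. (\<forall>n. c n \<in> homogeneous deg n) \<and> finite {n. c n \<noteq> 0} \<and> x = (\<Sum>n | c n \<noteq> 0. c n)"
  proof (rule ex_ex1I)
    show "\<exists>c. (\<forall>n. c n \<in> homogeneous deg n) \<and> finite {n. c n \<noteq> 0} \<and> x = (\<Sum>n | c n \<noteq> 0. c n)"
    proof (intro exI[of _ c] conjI allI)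
      show "c n \<in> homogeneous deg n" for n
        using keys_c[of n] by (auto simp: homogeneous_keys)
      show "finite {n. c n \<noteq> 0}"
        using fin by (rule finite_subset) simp
    qed (rule sum_c)
  next
    fix c d :: "nat \<Rightarrow> 'b \<Rightarrow>\<^sub>0 'k"
    have lookup: "Poly_Mapping.lookup (c n) b = (if deg b = n then Poly_Mapping.lookup x b else 0)"
      if c: "(\<forall>n. c n \<in> homogeneous deg n) \<and> finite {n. c n \<noteq> 0} \<and> x = (\<Sum>n | c n \<noteq> 0. c n)"
      for c :: "nat \<Rightarrow> 'b \<Rightarrow>\<^sub>0 'k" and n b
    proof -
      have off: "Poly_Mapping.lookup (c n) b = 0" if "deg b \<noteq> n" for n
      proof -
        have "b \<notin> Poly_Mapping.keys (c n)"
          using conjunct1[OF c] that by (auto simp: homogeneous_keys)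
        then show ?thesis by (simp add: in_keys_iff)
      qed
      have "Poly_Mapping.lookup x b = (\<Sum>n | c n \<noteq> 0. Poly_Mapping.lookup (c n) b)"
        using arg_cong[OF conjunct2[OF conjunct2[OF c]], of "\<lambda>x. Poly_Mapping.lookup x b"]
        by (simp only: lookup_sum)
      also have "\<dots> = (\<Sum>n | c n \<noteq> 0. if n = deg b then Poly_Mapping.lookup (c n) b else 0)"
        using off by (intro sum.cong) auto
      also have "\<dots> = Poly_Mapping.lookup (c (deg b)) b"
        using conjunct1[OF conjunct2[OF c]] by simp
      finally show ?thesis using off by auto
    qed
    assume c: "(\<forall>n. c n \<in> homogeneous deg n) \<and> finite {n. c n \<noteq> 0} \<and> x = (\<Sum>n | c n \<noteq> 0. c n)"
      and d: "(\<forall>n. d n \<in> homogeneous deg n) \<and> finite {n. d n \<noteq> 0} \<and> x = (\<Sum>n | d n \<noteq> 0. d n)"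
    show "c = d"
      by (intro ext poly_mapping_eqI) (simp only: lookup[OF c] lookup[OF d])
  qed
qed (rule subspace_homogeneous)

lemma tensor_component_homogeneous:
  assumes "Poly_Mapping.keys u \<subseteq> {(a, b). deg a + deg b = n}"
  shows "u \<in> tensor_component (homogeneous deg) n"
  unfolding tensor_component_def
proof (subst free_expansion, intro free.span_sum free.span_scale free.span_base)
  fix p assume "p \<in> Poly_Mapping.keys u"
  then have "deg (fst p) + deg (snd p) = n" using assms by auto
  then show "basis_vec p \<in> {x \<otimes> y | x y i j. x \<in> homogeneous deg i \<and> y \<in> homogeneous deg j \<and> i + j = n}"
    by (intro CollectI exI[of _ "basis_vec (fst p)"] exI[of _ "basis_vec (snd p)"]
        exI[of _ "deg (fst p)"] exI[of _ "deg (snd p)"]) (simp add: basis_vec_homogeneous)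
qed

lemma dim_homogeneous_0:
  assumes "\<And>b. deg b = 0 \<longleftrightarrow> b = e"
  shows "free.dim (homogeneous deg 0 :: ('b \<Rightarrow>\<^sub>0 'k::field) set) = 1"
proof -
  have "{basis_vec b | b. deg b = 0} = {basis_vec e :: 'b \<Rightarrow>\<^sub>0 'k}" using assms by auto
  moreover have "free.independent {basis_vec e :: 'b \<Rightarrow>\<^sub>0 'k}"
    by (rule free.independent_insertI) (simp_all add: free.independent_empty free.span_empty flip: keys_eq_empty)
  ultimately show ?thesis
    by (simp add: homogeneous_def free.dim_span free.dim_eq_card_independent)
qed

section \<open>Products and coproducts defined on a basis\<close>

text \<open>The product of the monoid algebra, when \<open>f\<close> is a monoid operation on the basis.\<close>

definition monoid_product ::
    "('b \<Rightarrow> 'b \<Rightarrow> 'b) \<Rightarrow> ('b \<Rightarrow>\<^sub>0 'k::field) \<Rightarrow> ('b \<Rightarrow>\<^sub>0 'k) \<Rightarrow> ('b \<Rightarrow>\<^sub>0 'k)"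
  where "monoid_product f x y = lin_ext (\<lambda>a. lin_ext (\<lambda>b. basis_vec (f a b)) y) x"

lemma monoid_product_basis [simp]:
  "monoid_product f (basis_vec a) (basis_vec b) = basis_vec (f a b)"
  by (simp add: monoid_product_def)

lemma bilin_monoid_product: "bilin (monoid_product f)"
  unfolding monoid_product_def[abs_def] by (rule bilin_lin_ext2)

lemma unital_algebra_monoid_product:
  assumes "\<And>a b c. f (f a b) c = f a (f b c)" "\<And>a. f e a = a" "\<And>a. f a e = a"
  shows "unital_algebra (monoid_product f) (basis_vec e)"
proof
  show "monoid_product f (monoid_product f x y) z = monoid_product f x (monoid_product f y z)"
    for x y z :: "'a \<Rightarrow>\<^sub>0 'b"
    by (simp add: monoid_product_def lin_ext_lin_ext assms(1))
qed (simp_all add: bilin_monoid_product, simp_all add: monoid_product_def assms)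

lemma monoid_product_homogeneous:
  assumes "\<And>a b. deg (f a b) = deg a + deg b" "x \<in> homogeneous deg i" "y \<in> homogeneous deg j"
  shows "monoid_product f x y \<in> homogeneous deg (i + j)"
  unfolding monoid_product_def
proof (rule lin_ext_homogeneous[OF lin_ext_homogeneous[OF _ assms(3)] assms(2)])
  show "basis_vec (f a b) \<in> homogeneous deg (i + j)" if "deg a = i" "deg b = j" for a b
    using basis_vec_homogeneous[of "f a b" deg] that by (simp add: assms(1))
qed

lemma lookup_lin_ext:
  "Poly_Mapping.lookup (lin_ext g x) c = (\<Sum>b\<in>Poly_Mapping.keys x. Poly_Mapping.lookup x b * Poly_Mapping.lookup (g b) c)"
  by (simp add: lin_ext_def lookup_sum)

text \<open>The coalgebra axioms need only be checked on basis vectors. The counit is the coordinate of one basis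
  vector \<open>e\<close>, which turns the counit axioms into a selection of the terms with \<open>e\<close> in one factor.\<close>

lemma counital_coalgebra_lin_ext:
  fixes \<delta> :: "'b \<Rightarrow> ('b \<times> 'b \<Rightarrow>\<^sub>0 'k::field)"
  assumes coassoc: "\<And>p. lin_ext (\<lambda>(a, c). lin_ext (\<lambda>(a1, a2). basis_vec (a1, a2, c)) (\<delta> a)) (\<delta> p) =
      lin_ext (\<lambda>(a, c). lin_ext (\<lambda>(c1, c2). basis_vec (a, c1, c2)) (\<delta> c)) (\<delta> p)"
    and left: "\<And>p. lin_ext (\<lambda>(a, c). if a = e then basis_vec c else 0) (\<delta> p) = basis_vec p"
    and right: "\<And>p. lin_ext (\<lambda>(a, c). if c = e then basis_vec a else 0) (\<delta> p) = basis_vec p"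
  shows "counital_coalgebra (lin_ext \<delta>) (\<lambda>x. Poly_Mapping.lookup x e)"
proof
  show "Poly_Mapping.lookup (x + y) e = Poly_Mapping.lookup x e + Poly_Mapping.lookup y e" for x y :: "'b \<Rightarrow>\<^sub>0 'k"
    by (rule lookup_add)
  have tensors: "v \<otimes> basis_vec c = lin_ext (\<lambda>a. basis_vec (a, c)) v"
    "basis_vec c \<otimes> v = lin_ext (\<lambda>a. basis_vec (c, a)) v"
    for c :: 'b and v :: "'b \<times> 'b \<Rightarrow>\<^sub>0 'k"
    by (simp_all add: tensor_alt)
  show "tensor_assoc (map_tensor (lin_ext \<delta>) id (lin_ext \<delta> x)) = map_tensor id (lin_ext \<delta>) (lin_ext \<delta> x)" for x
    unfolding map_tensor_eq tensor_assoc_eq lin_ext_lin_ext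
    by (rule lin_ext_cong) (use coassoc in \<open>simp add: tensors lin_ext_lin_ext case_prod_beta'\<close>)
  have scale: "Poly_Mapping.lookup (basis_vec a :: 'b \<Rightarrow>\<^sub>0 'k) e *\<^sub>K v = (if a = e then v else 0)"
    for a and v :: "'b \<Rightarrow>\<^sub>0 'k"
    by (simp add: lookup_single)
  show "tensor_lift (\<lambda>x y. Poly_Mapping.lookup x e *\<^sub>K y) (lin_ext \<delta> x) = x" for x
    unfolding tensor_lift_eq lin_ext_lin_ext scale left by simp
  show "tensor_lift (\<lambda>x y. Poly_Mapping.lookup y e *\<^sub>K x) (lin_ext \<delta> x) = x" for x
    unfolding tensor_lift_eq lin_ext_lin_ext scale right by simp
qed (simp_all add: lin_ext_add lin_ext_scale algebra_simps)

text \<open>If \<open>e\<close> has no factorization other than the trivial one, then its coordinate is a character.\<close>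

lemma lookup_monoid_product_unit:
  assumes "\<And>a b. f a b = e \<longleftrightarrow> a = e \<and> b = e"
  shows "Poly_Mapping.lookup (monoid_product f x y) e = Poly_Mapping.lookup x e * Poly_Mapping.lookup y e"
proof -
  have delta: "(\<Sum>b\<in>Poly_Mapping.keys z. Poly_Mapping.lookup z b * (if b = e then k else 0)) = Poly_Mapping.lookup z e * k"
    for z :: "'a \<Rightarrow>\<^sub>0 'b" and k
    by (simp add: if_distrib in_keys_iff cong: if_cong)
  have inner: "Poly_Mapping.lookup (lin_ext (\<lambda>b. basis_vec (f a b)) y) e = (if a = e then Poly_Mapping.lookup y e else 0)" for a
    using delta[of y 1] by (cases "a = e") (simp_all add: lookup_lin_ext lookup_single when_def assms)
  show ?thesis
    unfolding monoid_product_def lookup_lin_ext[of _ x] inner by (rule delta)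
qed

section \<open>Antipodes of connected graded bialgebras\<close>

definition convolution ::
    "(('b \<Rightarrow>\<^sub>0 'k) \<Rightarrow> ('b \<Rightarrow>\<^sub>0 'k) \<Rightarrow> ('b \<Rightarrow>\<^sub>0 'k)) \<Rightarrow> (('b \<Rightarrow>\<^sub>0 'k) \<Rightarrow> ('b \<times> 'b \<Rightarrow>\<^sub>0 'k)) \<Rightarrow>
      (('b \<Rightarrow>\<^sub>0 'k) \<Rightarrow> ('b \<Rightarrow>\<^sub>0 'k)) \<Rightarrow> (('b \<Rightarrow>\<^sub>0 'k) \<Rightarrow> ('b \<Rightarrow>\<^sub>0 'k)) \<Rightarrow> ('b \<Rightarrow>\<^sub>0 'k) \<Rightarrow> ('b \<Rightarrow>\<^sub>0 'k::field)"
  where "convolution m \<Delta> f g x = tensor_lift m (map_tensor f g (\<Delta> x))"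

text \<open>This is the setting of the convolution product, under which the linear endomorphisms form a monoid with
  neutral element \<open>\<eta>\<epsilon>\<close>. An antipode is an inverse of the identity in this monoid.\<close>

locale algebra_coalgebra = unital_algebra m e + counital_coalgebra \<Delta> \<epsilon>
  for m :: "('b \<Rightarrow>\<^sub>0 'k::field) \<Rightarrow> ('b \<Rightarrow>\<^sub>0 'k) \<Rightarrow> ('b \<Rightarrow>\<^sub>0 'k)" and e
    and \<Delta> :: "('b \<Rightarrow>\<^sub>0 'k) \<Rightarrow> ('b \<times> 'b \<Rightarrow>\<^sub>0 'k)" and \<epsilon>
begin

abbreviation conv (infixl \<open>\<star>\<close> 70)
  where "f \<star> g \<equiv> convolution m \<Delta> f g"

abbreviation unit_counit :: "('b \<Rightarrow>\<^sub>0 'k) \<Rightarrow> ('b \<Rightarrow>\<^sub>0 'k)"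
  where "unit_counit x \<equiv> \<epsilon> x *\<^sub>K e"

lemma convolution_eq:
  "(f \<star> g) x = lin_ext (\<lambda>(a, c). m (f (basis_vec a)) (g (basis_vec c))) (\<Delta> x)"
proof -
  have "tensor_lift m (map_tensor f g u) = lin_ext (\<lambda>(a, c). m (f (basis_vec a)) (g (basis_vec c))) u" for u
    unfolding map_tensor_eq flinear_of_lin_ext[OF flinear_tensor_lift]
    by (simp add: case_prod_beta' tensor_lift_tensor[OF mult_bilin])
  then show ?thesis by (simp add: convolution_def)
qed

lemma flinear_convolution: "flinear (f \<star> g)"
  unfolding convolution_eq[abs_def]
  by (rule flinear_compose[OF flinear_lin_ext comult_linear])

lemma flinear_unit_counit: "flinear unit_counit"
  using counit_linear
  by (intro flinearI)
    (simp_all add: Vector_Spaces.linear_def module_hom_def module_hom_axioms_def free.scale_left_distrib)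

lemma mult_lin_ext_left: "m (lin_ext f x) y = lin_ext (\<lambda>a. m (f a) y) x"
  by (rule flinear_of_lin_ext[OF bilin_flinear(2)[OF mult_bilin]])

lemma mult_lin_ext_right: "m y (lin_ext f x) = lin_ext (\<lambda>a. m y (f a)) x"
  by (rule flinear_of_lin_ext[OF bilin_flinear(1)[OF mult_bilin]])

text \<open>Both sides apply the threefold product of \<open>f\<close>, \<open>g\<close> and \<open>h\<close> to an iterated coproduct; coassociativity
  identifies the two iterated coproducts and associativity the two bracketings.\<close>

lemma convolution_assoc: "(f \<star> g) \<star> h = f \<star> (g \<star> h)"
proof
  fix x
  define F where "F = lin_ext (\<lambda>(a, b, c). m (f (basis_vec a)) (m (g (basis_vec b)) (h (basis_vec c))))"
  have tensors: "v \<otimes> basis_vec c = lin_ext (\<lambda>a. basis_vec (a, c)) v"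
    "basis_vec c \<otimes> w = lin_ext (\<lambda>a. basis_vec (c, a)) w"
    for c :: 'c and v :: "'d \<Rightarrow>\<^sub>0 'k" and w :: "'e \<Rightarrow>\<^sub>0 'k"
    by (simp_all add: tensor_alt)
  have "((f \<star> g) \<star> h) x = F (tensor_assoc (map_tensor \<Delta> id (\<Delta> x)))"
    by (simp add: F_def convolution_eq map_tensor_eq tensor_assoc_eq lin_ext_lin_ext tensors
        mult_lin_ext_left case_prod_beta' mult_assoc)
  also have "\<dots> = F (map_tensor id \<Delta> (\<Delta> x))"
    by (simp only: comult_coassoc)
  also have "\<dots> = (f \<star> (g \<star> h)) x"
    by (simp add: F_def convolution_eq map_tensor_eq lin_ext_lin_ext tensors
        mult_lin_ext_right case_prod_beta')
  finally show "((f \<star> g) \<star> h) x = (f \<star> (g \<star> h)) x" .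
qed

lemma convolution_unit_left: "flinear f \<Longrightarrow> unit_counit \<star> f = f"
proof
  fix x assume f: "flinear f"
  have "f x = f (tensor_lift (\<lambda>x y. \<epsilon> x *\<^sub>K y) (\<Delta> x))" by (simp add: counit_left)
  also have "\<dots> = (unit_counit \<star> f) x"
    by (simp add: convolution_eq tensor_lift_eq flinear_of_lin_ext[OF f] case_prod_beta'
        flinear_scale[OF f] flinear_scale[OF bilin_flinear(2)[OF mult_bilin]] mult_unit_left)
  finally show "(unit_counit \<star> f) x = f x" by simp
qed

lemma convolution_unit_right: "flinear f \<Longrightarrow> f \<star> unit_counit = f"
proof
  fix x assume f: "flinear f"
  have "f x = f (tensor_lift (\<lambda>x y. \<epsilon> y *\<^sub>K x) (\<Delta> x))" by (simp add: counit_right)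
  also have "\<dots> = (f \<star> unit_counit) x"
    by (simp add: convolution_eq tensor_lift_eq flinear_of_lin_ext[OF f] case_prod_beta'
        flinear_scale[OF f] flinear_scale[OF bilin_flinear(1)[OF mult_bilin]] mult_unit_right)
  finally show "(f \<star> unit_counit) x = f x" by simp
qed

lemma convolution_diff_left: "(\<lambda>x. f x - g x) \<star> h = (\<lambda>x. (f \<star> h) x - (g \<star> h) x)"
  and convolution_diff_right: "h \<star> (\<lambda>x. f x - g x) = (\<lambda>x. (h \<star> f) x - (h \<star> g) x)"
  by (simp_all add: fun_eq_iff convolution_eq case_prod_beta' flip: lin_ext_diff_fun
      add: flinear_diff[OF bilin_flinear(1)[OF mult_bilin]] flinear_diff[OF bilin_flinear(2)[OF mult_bilin]])

end

text \<open>Connectedness is \<open>deg_0\<close>: the unit is the only basis vector of degree \<open>0\<close>. The condition \<open>comult_deg\<close>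
  says that the coproduct is homogeneous.\<close>

locale connected_bialgebra = bialgebra m e \<Delta> \<epsilon>
  for m :: "('b \<Rightarrow>\<^sub>0 'k::field) \<Rightarrow> ('b \<Rightarrow>\<^sub>0 'k) \<Rightarrow> ('b \<Rightarrow>\<^sub>0 'k)" and e \<Delta> \<epsilon> +
  fixes deg :: "'b \<Rightarrow> nat"
  assumes comult_deg: "Poly_Mapping.keys (\<Delta> (basis_vec b)) \<subseteq> {(a, c). deg a + deg c = deg b}"
    and mult_deg: "x \<in> homogeneous deg i \<Longrightarrow> y \<in> homogeneous deg j \<Longrightarrow> m x y \<in> homogeneous deg (i + j)"
    and unit_deg: "e \<in> homogeneous deg 0"
    and counit_deg: "deg b \<noteq> 0 \<Longrightarrow> \<epsilon> (basis_vec b) = 0"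
    and deg_0: "deg b = 0 \<Longrightarrow> basis_vec b = e"
begin

sublocale algebra_coalgebra ..

definition unit_minus_id :: "('b \<Rightarrow>\<^sub>0 'k) \<Rightarrow> ('b \<Rightarrow>\<^sub>0 'k)"
  where "unit_minus_id x = unit_counit x - x"

text \<open>These are powers for \<open>\<star>\<close>, so they start from \<open>\<eta>\<epsilon>\<close> and not from the identity map.\<close>

fun unit_minus_id_power :: "nat \<Rightarrow> ('b \<Rightarrow>\<^sub>0 'k) \<Rightarrow> ('b \<Rightarrow>\<^sub>0 'k)"
  where "unit_minus_id_power 0 = unit_counit"
  | "unit_minus_id_power (Suc k) = unit_minus_id_power k \<star> unit_minus_id"

text \<open>The inverse of \<open>\<eta>\<epsilon> - u\<close> is the geometric series in \<open>u = \<eta>\<epsilon> - id\<close>. On a basis vector of degree \<open>n\<close> the powers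
  beyond the \<open>n\<close>-th vanish, so the series is cut off there.\<close>

definition antipode :: "('b \<Rightarrow>\<^sub>0 'k) \<Rightarrow> ('b \<Rightarrow>\<^sub>0 'k)"
  where "antipode = lin_ext (\<lambda>b. \<Sum>k\<le>deg b. unit_minus_id_power k (basis_vec b))"

lemma flinear_unit_minus_id: "flinear unit_minus_id"
  unfolding unit_minus_id_def[abs_def] by (intro flinear_diff_fun flinear_unit_counit flinear_id)

lemma flinear_unit_minus_id_power: "flinear (unit_minus_id_power k)"
  by (cases k) (simp_all add: flinear_unit_counit flinear_convolution)

text \<open>The powers are built by multiplication on the right. That left multiplication gives the same result is
  what makes the geometric series a two-sided inverse.\<close>

lemma unit_minus_id_power_commute: "unit_minus_id \<star> unit_minus_id_power k = unit_minus_id_power k \<star> unit_minus_id"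
proof (induction k)
  case 0
  show ?case by (simp add: convolution_unit_left convolution_unit_right flinear_unit_minus_id)
next
  case (Suc k)
  then show ?case by (simp flip: convolution_assoc)
qed

lemma unit_minus_id_deg_0: "deg b = 0 \<Longrightarrow> unit_minus_id (basis_vec b) = 0"
  by (simp add: unit_minus_id_def deg_0 counit_unit)

text \<open>In a term \<open>a \<otimes> c\<close> of the coproduct, either \<open>c\<close> has degree \<open>0\<close> and is killed by \<open>\<eta>\<epsilon> - id\<close>, or \<open>a\<close> has smaller
  degree and is killed by the preceding power.\<close>

lemma unit_minus_id_power_vanishes: "deg b < k \<Longrightarrow> unit_minus_id_power k (basis_vec b) = 0"
proof (induction k arbitrary: b)
  case (Suc k)
  have zero: "m (unit_minus_id_power k (basis_vec a)) (unit_minus_id (basis_vec c)) = 0" if "deg a + deg c = deg b" for a c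
  proof (cases "deg c = 0")
    case True
    then show ?thesis by (simp add: unit_minus_id_deg_0 flinear_zero[OF bilin_flinear(1)[OF mult_bilin]])
  next
    case False
    then have "deg a < k" using that Suc.prems by simp
    then show ?thesis by (simp add: Suc.IH flinear_zero[OF bilin_flinear(2)[OF mult_bilin]])
  qed
  have "unit_minus_id_power (Suc k) (basis_vec b) = lin_ext (\<lambda>_. 0) (\<Delta> (basis_vec b))"
    unfolding unit_minus_id_power.simps convolution_eq
    by (rule lin_ext_cong) (use comult_deg[of b] in \<open>auto simp: zero\<close>)
  then show ?case by (simp add: lin_ext_zero_fun)
qed simp

text \<open>The cut-off may be any bound of the degree. A common cut-off for all terms of a coproduct is what lets
  the sum over \<open>k\<close> be pulled out of the convolution.\<close>

lemma antipode_basis: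
  assumes "deg b \<le> n"
  shows "antipode (basis_vec b) = (\<Sum>k\<le>n. unit_minus_id_power k (basis_vec b))"
  unfolding antipode_def lin_ext_basis using assms
  by (intro sum.mono_neutral_left) (auto simp: unit_minus_id_power_vanishes)

lemma flinear_antipode: "flinear antipode"
  unfolding antipode_def by (rule flinear_lin_ext)

lemma id_eq_unit_diff: "id = (\<lambda>x. unit_counit x - unit_minus_id x)"
  by (simp add: fun_eq_iff unit_minus_id_def)

lemma unit_minus_id_power_telescope: "(\<Sum>k\<le>deg b. unit_minus_id_power k (basis_vec b) - unit_minus_id_power (Suc k) (basis_vec b)) = unit_counit (basis_vec b)"
  using sum_telescope[of "\<lambda>k. unit_minus_id_power k (basis_vec b)" "deg b"] unit_minus_id_power_vanishes[of b "Suc (deg b)"]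
  by simp

text \<open>Since \<open>id = \<eta>\<epsilon> - u\<close>, convolving the \<open>k\<close>-th power of \<open>u\<close> with \<open>id\<close> gives the \<open>k\<close>-th power minus the next one, and the
  series telescopes to its first term \<open>\<eta>\<epsilon>\<close>.\<close>

lemma antipode_convolution_left: "antipode \<star> id = unit_counit"
proof -
  have "(antipode \<star> id) (basis_vec b) = unit_counit (basis_vec b)" for b
  proof -
    have "(antipode \<star> id) (basis_vec b) =
      lin_ext (\<lambda>ac. \<Sum>k\<le>deg b. m (unit_minus_id_power k (basis_vec (fst ac))) (basis_vec (snd ac))) (\<Delta> (basis_vec b))"
      unfolding convolution_eq
    proof (rule lin_ext_cong, clarify)
      fix a c assume "(a, c) \<in> Poly_Mapping.keys (\<Delta> (basis_vec b))"
      then have "deg a \<le> deg b" using comult_deg[of b] by auto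
      then show "m (antipode (basis_vec a)) (id (basis_vec c)) =
          (\<Sum>k\<le>deg b. m (unit_minus_id_power k (basis_vec (fst (a, c)))) (basis_vec (snd (a, c))))"
        by (simp add: antipode_basis flinear_sum[OF bilin_flinear(2)[OF mult_bilin]])
    qed
    also have "\<dots> = (\<Sum>k\<le>deg b. (unit_minus_id_power k \<star> id) (basis_vec b))"
      by (simp add: lin_ext_sum_fun convolution_eq case_prod_beta')
    also have "\<dots> = (\<Sum>k\<le>deg b. unit_minus_id_power k (basis_vec b) - unit_minus_id_power (Suc k) (basis_vec b))"
      unfolding id_eq_unit_diff convolution_diff_right
      by (simp add: convolution_unit_right flinear_unit_minus_id_power)
    finally show ?thesis by (simp only: unit_minus_id_power_telescope)
  qed
  then show ?thesis by (rule flinear_eqI[OF flinear_convolution flinear_unit_counit])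
qed

lemma antipode_convolution_right: "id \<star> antipode = unit_counit"
proof -
  have "(id \<star> antipode) (basis_vec b) = unit_counit (basis_vec b)" for b
  proof -
    have "(id \<star> antipode) (basis_vec b) =
      lin_ext (\<lambda>ac. \<Sum>k\<le>deg b. m (basis_vec (fst ac)) (unit_minus_id_power k (basis_vec (snd ac)))) (\<Delta> (basis_vec b))"
      unfolding convolution_eq
    proof (rule lin_ext_cong, clarify)
      fix a c assume "(a, c) \<in> Poly_Mapping.keys (\<Delta> (basis_vec b))"
      then have "deg c \<le> deg b" using comult_deg[of b] by auto
      then show "m (id (basis_vec a)) (antipode (basis_vec c)) =
          (\<Sum>k\<le>deg b. m (basis_vec (fst (a, c))) (unit_minus_id_power k (basis_vec (snd (a, c)))))"
        by (simp add: antipode_basis flinear_sum[OF bilin_flinear(1)[OF mult_bilin]])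
    qed
    also have "\<dots> = (\<Sum>k\<le>deg b. (id \<star> unit_minus_id_power k) (basis_vec b))"
      by (simp add: lin_ext_sum_fun convolution_eq case_prod_beta')
    also have "\<dots> = (\<Sum>k\<le>deg b. unit_minus_id_power k (basis_vec b) - unit_minus_id_power (Suc k) (basis_vec b))"
      unfolding id_eq_unit_diff convolution_diff_left
      by (simp add: convolution_unit_left flinear_unit_minus_id_power unit_minus_id_power_commute)
    finally show ?thesis by (simp only: unit_minus_id_power_telescope)
  qed
  then show ?thesis by (rule flinear_eqI[OF flinear_convolution flinear_unit_counit])
qed

lemma unit_counit_homogeneous: "unit_counit (basis_vec b) \<in> homogeneous deg (deg b)"
  using unit_deg by (cases "deg b = 0")
    (simp_all add: counit_deg free.subspace_scale[OF subspace_homogeneous] free.subspace_0[OF subspace_homogeneous])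

lemma unit_minus_id_homogeneous: "unit_minus_id (basis_vec b) \<in> homogeneous deg (deg b)"
  unfolding unit_minus_id_def
  by (intro free.subspace_diff[OF subspace_homogeneous] unit_counit_homogeneous basis_vec_homogeneous)

lemma unit_minus_id_power_homogeneous: "unit_minus_id_power k (basis_vec b) \<in> homogeneous deg (deg b)"
proof (induction k arbitrary: b)
  case 0
  show ?case using unit_counit_homogeneous[of b] by simp
next
  case (Suc k)
  have "m (unit_minus_id_power k (basis_vec a)) (unit_minus_id (basis_vec c)) \<in> homogeneous deg (deg b)"
    if "deg a + deg c = deg b" for a c
    using mult_deg[OF Suc.IH[of a] unit_minus_id_homogeneous[of c]] that by simp
  moreover have "\<Delta> (basis_vec b) \<in> homogeneous (\<lambda>(a, c). deg a + deg c) (deg b)"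
    using comult_deg[of b] by (auto simp: homogeneous_keys)
  ultimately show ?case
    unfolding unit_minus_id_power.simps convolution_eq by (intro lin_ext_homogeneous) auto
qed

lemma antipode_homogeneous: "x \<in> homogeneous deg n \<Longrightarrow> antipode x \<in> homogeneous deg n"
  unfolding antipode_def
  by (rule lin_ext_homogeneous)
    (auto intro: free.subspace_sum[OF subspace_homogeneous] unit_minus_id_power_homogeneous)

lemma grading: "grading (homogeneous deg) m e \<Delta> \<epsilon>"
proof -
  interpret graded_space "homogeneous deg :: nat \<Rightarrow> ('b \<Rightarrow>\<^sub>0 'k) set" by (rule graded_space_homogeneous)
  show ?thesis
  proof
    fix x :: "'b \<Rightarrow>\<^sub>0 'k" and n
    assume x: "x \<in> homogeneous deg n"
    have "\<Delta> (basis_vec b) \<in> homogeneous (\<lambda>(a, c). deg a + deg c) n" if "deg b = n" for b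
      using comult_deg[of b] that by (auto simp: homogeneous_keys)
    then have "\<Delta> x \<in> homogeneous (\<lambda>(a, c). deg a + deg c) n"
      unfolding flinear_lin_ext_eq[OF comult_linear, of x] using x by (rule lin_ext_homogeneous)
    then show "\<Delta> x \<in> tensor_component (homogeneous deg) n"
      by (intro tensor_component_homogeneous) (auto simp: homogeneous_keys)
    assume "n \<noteq> 0"
    interpret counit: Vector_Spaces.linear fscale "(*)" \<epsilon> by (rule counit_linear)
    have "\<epsilon> x = (\<Sum>b\<in>Poly_Mapping.keys x. Poly_Mapping.lookup x b * \<epsilon> (basis_vec b))"
      by (subst free_expansion) (simp add: counit.sum counit.scale)
    also have "\<dots> = 0"
    proof (rule sum.neutral, rule ballI)
      fix b assume "b \<in> Poly_Mapping.keys x"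
      then have "deg b \<noteq> 0" using x \<open>n \<noteq> 0\<close> by (auto simp: homogeneous_keys)
      then show "Poly_Mapping.lookup x b * \<epsilon> (basis_vec b) = 0" by (simp add: counit_deg)
    qed
    finally show "\<epsilon> x = 0" .
  qed (simp_all add: unit_deg mult_deg)
qed

theorem graded_hopf_algebra: "graded_hopf_algebra m e \<Delta> \<epsilon> antipode (homogeneous deg)"
proof -
  interpret grading "homogeneous deg" m e \<Delta> \<epsilon> by (rule grading)
  show ?thesis
  proof
    show "tensor_lift m (map_tensor antipode id (\<Delta> x)) = \<epsilon> x *\<^sub>K e" for x
      using fun_cong[OF antipode_convolution_left, of x] by (simp add: convolution_def)
    show "tensor_lift m (map_tensor id antipode (\<Delta> x)) = \<epsilon> x *\<^sub>K e" for x
      using fun_cong[OF antipode_convolution_right, of x] by (simp add: convolution_def)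
  qed (simp_all add: flinear_add[OF flinear_antipode] flinear_scale[OF flinear_antipode] antipode_homogeneous)
qed

end

section \<open>Isomorphism classes of double posets\<close>

definition dp_one :: dp
  where "dp_one = dp_class (empty_dposet :: nat dposet)"

lemma double_poset_empty: "double_poset empty_dposet"
  by (simp add: double_poset_def empty_dposet_def partial_order_on_def preorder_on_def refl_on_def)

lemma dp_cases:
  obtains P :: "nat dposet" where "double_poset P" "p = dp_class P"
  by (metis double_poset_rep dp_class_rep)

lemma dp_class_eq_one_iff:
  assumes "double_poset P"
  shows "dp_class P = dp_one \<longleftrightarrow> points P = {}"
proof -
  have "dp_class P = dp_one \<longleftrightarrow> dposet_iso P (empty_dposet :: nat dposet)"
    unfolding dp_one_def by (rule dp_class_eq_iff[OF assms double_poset_empty])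
  also have "\<dots> \<longleftrightarrow> points P = {}"
    by (auto simp: dposet_iso_def is_dposet_iso_def empty_dposet_def bij_betw_def)
  finally show ?thesis .
qed

lemma dp_size_eq_0_iff: "dp_size p = 0 \<longleftrightarrow> p = dp_one"
proof (cases p rule: dp_cases)
  case (1 P)
  then show ?thesis
    using double_posetD(1)[OF 1(1)] by (simp add: dp_size_class dp_class_eq_one_iff)
qed

lemmas dposet_rel_simps = is_dposet_iso_def dposet_leadsto_def dposet_natural_def disj_rel_mem

lemma dposet_sum_assoc:
  "dposet_iso (dposet_leadsto (dposet_leadsto P Q) R) (dposet_leadsto P (dposet_leadsto Q R))"
  "dposet_iso (dposet_natural (dposet_natural P Q) R) (dposet_natural P (dposet_natural Q R))"
proof -
  let ?f = "case_sum (case_sum Inl (Inr \<circ> Inl)) (Inr \<circ> Inr)"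
  let ?g = "case_sum (Inl \<circ> Inl) (case_sum (Inl \<circ> Inr) Inr)"
  have bij: "bij_betw ?f ((A <+> B) <+> C) (A <+> (B <+> C))" for A B C
    by (rule bij_betw_byWitness[where f' = ?g]) auto
  have "is_dposet_iso ?f (dposet_leadsto (dposet_leadsto P Q) R) (dposet_leadsto P (dposet_leadsto Q R))"
    using bij by (auto simp: dposet_rel_simps)
  moreover have "is_dposet_iso ?f (dposet_natural (dposet_natural P Q) R) (dposet_natural P (dposet_natural Q R))"
    using bij by (auto simp: dposet_rel_simps)
  ultimately show "dposet_iso (dposet_leadsto (dposet_leadsto P Q) R) (dposet_leadsto P (dposet_leadsto Q R))"
    "dposet_iso (dposet_natural (dposet_natural P Q) R) (dposet_natural P (dposet_natural Q R))"
    unfolding dposet_iso_def by blast+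
qed

lemma dposet_isoI: "is_dposet_iso f P Q \<Longrightarrow> dposet_iso P Q"
  unfolding dposet_iso_def by blast

lemma dposet_sum_empty:
  "is_dposet_iso Inr P (dposet_leadsto empty_dposet P)" "is_dposet_iso Inl P (dposet_leadsto P empty_dposet)"
  "is_dposet_iso Inr P (dposet_natural empty_dposet P)" "is_dposet_iso Inl P (dposet_natural P empty_dposet)"
  by (auto simp: dposet_rel_simps empty_dposet_def bij_betw_def)

lemma dp_leadsto_assoc: "dp_leadsto (dp_leadsto p q) r = dp_leadsto p (dp_leadsto q r)"
  and dp_natural_assoc: "dp_natural (dp_natural p q) r = dp_natural p (dp_natural q r)"
proof -
  obtain P Q R :: "nat dposet" where "double_poset P" "p = dp_class P"
      "double_poset Q" "q = dp_class Q" "double_poset R" "r = dp_class R"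
    by (metis dp_cases)
  then show "dp_leadsto (dp_leadsto p q) r = dp_leadsto p (dp_leadsto q r)"
    and "dp_natural (dp_natural p q) r = dp_natural p (dp_natural q r)"
    by (simp_all add: dp_leadsto_class dp_natural_class double_poset_leadsto double_poset_natural
        dp_class_eq_iff dposet_sum_assoc)
qed

lemma dp_unit:
  "dp_leadsto dp_one p = p" "dp_leadsto p dp_one = p"
  "dp_natural dp_one p = p" "dp_natural p dp_one = p"
proof -
  obtain P :: "nat dposet" where P: "double_poset P" "p = dp_class P"
    by (rule dp_cases)
  have "dposet_iso (dposet_leadsto empty_dposet P) P" "dposet_iso (dposet_leadsto P empty_dposet) P"
    "dposet_iso (dposet_natural empty_dposet P) P" "dposet_iso (dposet_natural P empty_dposet) P"
    by (rule dposet_sum_empty[THEN dposet_isoI, THEN dposet_iso_sym])+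
  with P show "dp_leadsto dp_one p = p" "dp_leadsto p dp_one = p"
    "dp_natural dp_one p = p" "dp_natural p dp_one = p"
    by (simp_all add: dp_one_def dp_leadsto_class dp_natural_class double_poset_empty
        double_poset_leadsto double_poset_natural dp_class_eq_iff)
qed

lemma points_sum [simp]:
  "points (dposet_leadsto P Q) = points P <+> points Q"
  "points (dposet_natural P Q) = points P <+> points Q"
  by (simp_all add: dposet_leadsto_def dposet_natural_def)

lemma dp_size_leadsto: "dp_size (dp_leadsto p q) = dp_size p + dp_size q"
  and dp_size_natural: "dp_size (dp_natural p q) = dp_size p + dp_size q"
proof -
  obtain P Q :: "nat dposet" where PQ: "double_poset P" "p = dp_class P" "double_poset Q" "q = dp_class Q"
    by (metis dp_cases)
  then show "dp_size (dp_leadsto p q) = dp_size p + dp_size q"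
    and "dp_size (dp_natural p q) = dp_size p + dp_size q"
    using double_posetD(1)[OF PQ(1)] double_posetD(1)[OF PQ(3)]
    by (simp_all add: dp_leadsto_class dp_natural_class dp_size_class double_poset_leadsto
        double_poset_natural points_sum card_Plus)
qed

section \<open>Ideals and the coproduct\<close>

lemma points_sub [simp]: "points (sub_dposet P A) = A"
  by (simp add: sub_dposet_def)

lemma sub_sub: "B \<subseteq> A \<Longrightarrow> sub_dposet (sub_dposet P A) B = sub_dposet P B"
  by (auto simp: sub_dposet_def)

lemma sub_points: "double_poset P \<Longrightarrow> sub_dposet P (points P) = P"
  by (rule dposet.equality) (use double_posetD(2,3) in \<open>fastforce simp: sub_dposet_def\<close>)+

lemma finite_ideals: "double_poset P \<Longrightarrow> finite (ideals P)"
  by (rule finite_subset[of _ "Pow (points P)"]) (auto simp: ideals_def double_posetD(1))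

lemma ideals_subset: "I \<in> ideals P \<Longrightarrow> I \<subseteq> points P"
  by (simp add: ideals_def)

lemma empty_in_ideals: "{} \<in> ideals P" and points_in_ideals: "points P \<in> ideals P"
  by (auto simp: ideals_def)

lemma dp_coproduct_class_sum:
  assumes "double_poset P"
  shows "dp_coproduct (dp_class P) =
    (\<Sum>I\<in>ideals P. basis_vec (dp_class (sub_dposet P (points P - I)), dp_class (sub_dposet P I)))"
  using dp_coproduct_class[OF assms] by simp

lemma keys_dp_coproduct:
  "Poly_Mapping.keys (dp_coproduct p :: _ \<Rightarrow>\<^sub>0 'k::field) \<subseteq> {(a, c). dp_size a + dp_size c = dp_size p}"
proof -
  obtain P :: "nat dposet" where P: "double_poset P" "p = dp_class P" by (rule dp_cases)
  have "dp_size (dp_class (sub_dposet P (points P - I))) + dp_size (dp_class (sub_dposet P I)) = dp_size p"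
    if "I \<in> ideals P" for I
    using ideals_subset[OF that] double_posetD(1)[OF P(1)]
    by (simp add: P dp_size_class double_poset_sub card_Diff_subset card_mono finite_subset)
  moreover have "Poly_Mapping.keys (dp_coproduct p :: _ \<Rightarrow>\<^sub>0 'k) \<subseteq>
      (\<Union>I\<in>ideals P. Poly_Mapping.keys (basis_vec
        (dp_class (sub_dposet P (points P - I)), dp_class (sub_dposet P I)) :: _ \<Rightarrow>\<^sub>0 'k))"
    unfolding P(2) dp_coproduct_class_sum[OF P(1)] by (rule keys_sum)
  ultimately show ?thesis by fastforce
qed

lemma dp_coproduct_counit:
  "lin_ext (\<lambda>(a, c). if a = dp_one then basis_vec c else 0) (dp_coproduct p) = basis_vec p" (is ?left)
  "lin_ext (\<lambda>(a, c). if c = dp_one then basis_vec a else 0) (dp_coproduct p) = basis_vec p" (is ?right)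
proof -
  obtain P :: "nat dposet" where P: "double_poset P" "p = dp_class P" by (rule dp_cases)
  have one: "dp_class (sub_dposet P A) = dp_one \<longleftrightarrow> A = {}" if "A \<subseteq> points P" for A
    using dp_class_eq_one_iff[OF double_poset_sub[OF P(1) that]] by simp
  have "lin_ext (\<lambda>(a, c). if a = dp_one then basis_vec c else 0) (dp_coproduct p) =
      (\<Sum>I\<in>ideals P. if I = points P then basis_vec p else 0)"
    unfolding P(2) dp_coproduct_class_sum[OF P(1)] lin_ext_sum
    by (intro sum.cong refl) (auto simp: one sub_points P dest: ideals_subset)
  then show ?left by (simp add: finite_ideals P points_in_ideals)
  have "lin_ext (\<lambda>(a, c). if c = dp_one then basis_vec a else 0) (dp_coproduct p) =
      (\<Sum>I\<in>ideals P. if I = {} then basis_vec p else 0)"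
    unfolding P(2) dp_coproduct_class_sum[OF P(1)] lin_ext_sum
    by (intro sum.cong refl) (auto simp: one sub_points P dest: ideals_subset)
  then show ?right by (simp add: finite_ideals P empty_in_ideals)
qed

lemma ideals_of_ideal: "I \<in> ideals P \<Longrightarrow> ideals (sub_dposet P I) = {J \<in> ideals P. J \<subseteq> I}"
  by (auto simp: ideals_def sub_dposet_def)

text \<open>Together with \<open>ideals_of_ideal\<close>, this lets both iterated coproducts be indexed by chains of two ideals.\<close>

lemma bij_betw_ideals_of_complement:
  assumes "I \<in> ideals P"
  shows "bij_betw (\<lambda>J. J - I) {J \<in> ideals P. I \<subseteq> J} (ideals (sub_dposet P (points P - I)))"
proof (rule bij_betw_byWitness[where f' = "\<lambda>K. K \<union> I"])
  show "(\<lambda>K. K \<union> I) ` ideals (sub_dposet P (points P - I)) \<subseteq> {J \<in> ideals P. I \<subseteq> J}"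
    using assms by (auto simp: ideals_def sub_dposet_def)
qed (auto simp: ideals_def sub_dposet_def)

text \<open>In both iterated coproducts the terms correspond to the chains \<open>I \<subseteq> J\<close> of ideals. On the left the outer
  sum chooses \<open>I\<close>, on the right it chooses \<open>J\<close>, so the two differ by exchanging the summations.\<close>

lemma dp_coproduct_coassoc:
  "lin_ext (\<lambda>(a, c). lin_ext (\<lambda>(a1, a2). basis_vec (a1, a2, c)) (dp_coproduct a)) (dp_coproduct p) =
    lin_ext (\<lambda>(a, c). lin_ext (\<lambda>(c1, c2). basis_vec (a, c1, c2)) (dp_coproduct c)) (dp_coproduct p)"
  (is "?L = ?R")
proof -
  obtain P :: "nat dposet" where P: "double_poset P" "p = dp_class P" by (rule dp_cases)
  \<comment> \<open>the term belonging to the chain \<open>I \<subseteq> J\<close>\<close>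
  define G :: "nat set \<Rightarrow> nat set \<Rightarrow> (dp \<times> dp \<times> dp \<Rightarrow>\<^sub>0 'a)" where
    "G I J = basis_vec (dp_class (sub_dposet P (points P - J)), dp_class (sub_dposet P (J - I)), dp_class (sub_dposet P I))" for I J
  have "?L = (\<Sum>I\<in>ideals P. \<Sum>K\<in>ideals (sub_dposet P (points P - I)).
      basis_vec (dp_class (sub_dposet P (points P - I - K)), dp_class (sub_dposet P K), dp_class (sub_dposet P I)))"
    unfolding P(2) dp_coproduct_class_sum[OF P(1)] lin_ext_sum
  proof (rule sum.cong[OF refl])
    fix I assume "I \<in> ideals P"
    have "K \<subseteq> points P - I" if "K \<in> ideals (sub_dposet P (points P - I))" for K
      using ideals_subset[OF that] by simp
    then show "lin_ext (\<lambda>(a, c). lin_ext (\<lambda>(a1, a2). basis_vec (a1, a2, c)) (dp_coproduct a))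
        (basis_vec (dp_class (sub_dposet P (points P - I)), dp_class (sub_dposet P I))) =
      (\<Sum>K\<in>ideals (sub_dposet P (points P - I)).
        basis_vec (dp_class (sub_dposet P (points P - I - K)), dp_class (sub_dposet P K), dp_class (sub_dposet P I)))"
      by (simp add: dp_coproduct_class_sum double_poset_sub P(1) lin_ext_sum sub_sub cong: sum.cong)
  qed
  also have "\<dots> = (\<Sum>I\<in>ideals P. \<Sum>J | J \<in> ideals P \<and> I \<subseteq> J. G I J)"
  proof (rule sum.cong[OF refl])
    fix I assume I: "I \<in> ideals P"
    have "points P - I - (J - I) = points P - J" if "I \<subseteq> J" for J
      using that by blast
    then show "(\<Sum>K\<in>ideals (sub_dposet P (points P - I)).
        basis_vec (dp_class (sub_dposet P (points P - I - K)), dp_class (sub_dposet P K), dp_class (sub_dposet P I))) =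
        (\<Sum>J | J \<in> ideals P \<and> I \<subseteq> J. G I J)"
      by (subst sum.reindex_bij_betw[OF bij_betw_ideals_of_complement[OF I], symmetric])
        (simp add: G_def)
  qed
  also have "\<dots> = (\<Sum>J\<in>ideals P. \<Sum>I | I \<in> ideals P \<and> I \<subseteq> J. G I J)"
    by (rule sum.swap_restrict) (simp_all add: finite_ideals P(1))
  also have "\<dots> = ?R"
    unfolding P(2) dp_coproduct_class_sum[OF P(1)] lin_ext_sum
  proof (rule sum.cong[OF refl])
    fix J assume J: "J \<in> ideals P"
    then show "(\<Sum>I | I \<in> ideals P \<and> I \<subseteq> J. G I J) =
      lin_ext (\<lambda>(a, c). lin_ext (\<lambda>(c1, c2). basis_vec (a, c1, c2)) (dp_coproduct c))
        (basis_vec (dp_class (sub_dposet P (points P - J)), dp_class (sub_dposet P J)))"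
      using ideals_subset[OF J]
      by (simp add: dp_coproduct_class_sum double_poset_sub P(1) lin_ext_sum ideals_of_ideal sub_sub G_def)
  qed
  finally show ?thesis .
qed

section \<open>The coproduct of a product\<close>

lemma sub_sum:
  assumes "A \<subseteq> points P" "B \<subseteq> points Q"
  shows "sub_dposet (dposet_leadsto P Q) (A <+> B) = dposet_leadsto (sub_dposet P A) (sub_dposet Q B)"
    and "sub_dposet (dposet_natural P Q) (A <+> B) = dposet_natural (sub_dposet P A) (sub_dposet Q B)"
proof -
  have rel: "disj_rel r s \<inter> (A <+> B) \<times> (A <+> B) = disj_rel (r \<inter> A \<times> A) (s \<inter> B \<times> B)" for r s
    by (auto simp: disj_rel_def)
  have cross: "(Inl ` points P \<times> Inr ` points Q) \<inter> (A <+> B) \<times> (A <+> B) = Inl ` A \<times> Inr ` B"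
    using assms by auto
  show "sub_dposet (dposet_leadsto P Q) (A <+> B) = dposet_leadsto (sub_dposet P A) (sub_dposet Q B)"
    and "sub_dposet (dposet_natural P Q) (A <+> B) = dposet_natural (sub_dposet P A) (sub_dposet Q B)"
    by (simp_all add: sub_dposet_def dposet_leadsto_def dposet_natural_def Int_Un_distrib2 rel cross)
qed

lemma Plus_Diff: "(A <+> B) - (C <+> D) = (A - C) <+> (B - D)"
  by auto

lemma ball_Plus: "(\<forall>x\<in>A <+> B. R x) \<longleftrightarrow> (\<forall>a\<in>A. R (Inl a)) \<and> (\<forall>b\<in>B. R (Inr b))"
  and Inl_in_Plus: "Inl a \<in> A <+> B \<longleftrightarrow> a \<in> A"
  and Inr_in_Plus: "Inr b \<in> A <+> B \<longleftrightarrow> b \<in> B"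
  by auto

lemma Plus_subset_iff: "A <+> B \<subseteq> C <+> D \<longleftrightarrow> A \<subseteq> C \<and> B \<subseteq> D"
  by (auto simp: subset_eq ball_Plus Inl_in_Plus Inr_in_Plus)

lemma Plus_eq_iff: "A <+> B = C <+> D \<longleftrightarrow> A = C \<and> B = D"
  by (auto simp: Plus_subset_iff set_eq_subset)

lemma subset_Plus_cases:
  assumes "X \<subseteq> A <+> B"
  obtains C D where "X = C <+> D"
proof
  show "X = Inl -` X <+> Inr -` X" using assms by auto
qed

text \<open>The first order has no relation between the two parts, so closure can be checked in each part separately.\<close>

lemma ideals_leadsto: "ideals (dposet_leadsto P Q) = (\<lambda>(I, J). I <+> J) ` (ideals P \<times> ideals Q)"
proof -
  have iff: "I <+> J \<in> ideals (dposet_leadsto P Q) \<longleftrightarrow> I \<in> ideals P \<and> J \<in> ideals Q" for I J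
    by (auto simp: ideals_def dposet_leadsto_def disj_rel_mem ball_Plus Plus_subset_iff Inl_in_Plus Inr_in_Plus)
  show ?thesis
  proof (intro equalityI subsetI)
    fix X assume X: "X \<in> ideals (dposet_leadsto P Q)"
    obtain I J where "X = I <+> J"
      using ideals_subset[OF X] unfolding points_sum by (rule subset_Plus_cases)
    then show "X \<in> (\<lambda>(I, J). I <+> J) ` (ideals P \<times> ideals Q)"
      using X iff by auto
  qed (use iff in auto)
qed

text \<open>As soon as an ideal contains an element of the left part, it contains everything above it, in particular
  the whole right part.\<close>

lemma ideals_natural:
  "ideals (dposet_natural P Q) = (\<lambda>J. {} <+> J) ` ideals Q \<union> (\<lambda>I. I <+> points Q) ` ideals P"
proof -
  have iff: "I <+> J \<in> ideals (dposet_natural P Q) \<longleftrightarrow>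
      I \<in> ideals P \<and> J \<in> ideals Q \<and> (I = {} \<or> J = points Q)" for I J
  proof -
    have "I <+> J \<in> ideals (dposet_natural P Q) \<longleftrightarrow>
        I \<in> ideals P \<and> J \<in> ideals Q \<and> (\<forall>x\<in>I. \<forall>y\<in>points Q. y \<in> J)"
      by (auto simp: ideals_def dposet_natural_def disj_rel_mem ball_Plus Plus_subset_iff Inl_in_Plus Inr_in_Plus)
    then show ?thesis by (auto simp: ideals_def)
  qed
  show ?thesis
  proof (intro equalityI subsetI)
    fix X assume X: "X \<in> ideals (dposet_natural P Q)"
    obtain I J where "X = I <+> J"
      using ideals_subset[OF X] unfolding points_sum by (rule subset_Plus_cases)
    then show "X \<in> (\<lambda>J. {} <+> J) ` ideals Q \<union> (\<lambda>I. I <+> points Q) ` ideals P"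
      using X iff by auto
  qed (use iff empty_in_ideals points_in_ideals in auto)
qed

lemma dp_coproduct_leadsto:
  "dp_coproduct (dp_leadsto p q) =
    tensor_mult (monoid_product dp_leadsto) (dp_coproduct p) (dp_coproduct q)"
proof -
  obtain P Q :: "nat dposet" where P: "double_poset P" "p = dp_class P" and Q: "double_poset Q" "q = dp_class Q"
    by (metis dp_cases)
  have inj: "inj_on (\<lambda>(I, J). I <+> J) (ideals P \<times> ideals Q)"
    by (auto simp: inj_on_def Plus_eq_iff)
  have sub: "dp_class (sub_dposet (dposet_leadsto P Q) (A <+> B)) =
      dp_leadsto (dp_class (sub_dposet P A)) (dp_class (sub_dposet Q B))"
    if "A \<subseteq> points P" "B \<subseteq> points Q" for A B
    using that by (simp add: sub_sum dp_leadsto_class double_poset_sub P Q)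
  have "dp_coproduct (dp_leadsto p q) = (\<Sum>I\<in>ideals P. \<Sum>J\<in>ideals Q. basis_vec
      (dp_leadsto (dp_class (sub_dposet P (points P - I))) (dp_class (sub_dposet Q (points Q - J))),
       dp_leadsto (dp_class (sub_dposet P I)) (dp_class (sub_dposet Q J))))"
    unfolding P(2) Q(2) dp_leadsto_class[OF P(1) Q(1)]
      dp_coproduct_class_sum[OF double_poset_leadsto[OF P(1) Q(1)]]
      ideals_leadsto sum.reindex[OF inj] sum.cartesian_product points_sum
    by (intro sum.cong refl) (auto simp: Plus_Diff sub ideals_subset)
  also have "\<dots> = tensor_mult (monoid_product dp_leadsto) (dp_coproduct p) (dp_coproduct q)"
    unfolding P(2) Q(2) dp_coproduct_class_sum[OF P(1)] dp_coproduct_class_sum[OF Q(1)]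
      tensor_mult_eq lin_ext_sum by simp
  finally show ?thesis .
qed

text \<open>The ideals that avoid the left part give the first product, and those that contain the right part give
  the second. The right part itself belongs to both families, so its term is counted twice.\<close>

lemma dp_coproduct_natural:
  "dp_coproduct (dp_natural p q) =
    tensor_mult (monoid_product dp_natural) (basis_vec p \<otimes> basis_vec dp_one) (dp_coproduct q) +
    tensor_mult (monoid_product dp_natural) (dp_coproduct p) (basis_vec dp_one \<otimes> basis_vec q) -
    basis_vec p \<otimes> basis_vec q"
proof -
  obtain P Q :: "nat dposet" where P: "double_poset P" "p = dp_class P" and Q: "double_poset Q" "q = dp_class Q"
    by (metis dp_cases)
  have sub: "dp_class (sub_dposet (dposet_natural P Q) (A <+> B)) =
      dp_natural (dp_class (sub_dposet P A)) (dp_class (sub_dposet Q B))"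
    if "A \<subseteq> points P" "B \<subseteq> points Q" for A B
    using that by (simp add: sub_sum dp_natural_class double_poset_sub P Q)
  have empty: "dp_class (sub_dposet R {}) = dp_one" if "double_poset R" for R :: "nat dposet"
    using dp_class_eq_one_iff[OF double_poset_sub[OF that], of "{}"] by simp
  let ?N = "dposet_natural P Q"
  define g :: "(nat + nat) set \<Rightarrow> (dp \<times> dp \<Rightarrow>\<^sub>0 'a)" where
    "g X = basis_vec (dp_class (sub_dposet ?N (points ?N - X)), dp_class (sub_dposet ?N X))" for X
  let ?B = "(\<lambda>J. {} <+> J) ` ideals Q" and ?A = "(\<lambda>I. I <+> points Q) ` ideals P"
  have sumB: "sum g ?B = tensor_mult (monoid_product dp_natural) (basis_vec p \<otimes> basis_vec dp_one) (dp_coproduct q)"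
  proof -
    have vals: "g ({} <+> J) = basis_vec (dp_natural p (dp_class (sub_dposet Q (points Q - J))), dp_class (sub_dposet Q J))"
      if "J \<in> ideals Q" for J
      using ideals_subset[OF that] by (simp add: g_def Plus_Diff sub empty sub_points P dp_unit)
    have inj: "inj_on (\<lambda>J. {} <+> J) (ideals Q)"
      by (rule inj_onI) (simp add: Plus_eq_iff)
    have "sum g ?B = (\<Sum>J\<in>ideals Q.
        basis_vec (dp_natural p (dp_class (sub_dposet Q (points Q - J))), dp_class (sub_dposet Q J)))"
      unfolding sum.reindex[OF inj] by (rule sum.cong) (simp_all add: vals)
    then show ?thesis
      by (simp add: Q(2) dp_coproduct_class_sum[OF Q(1)] tensor_mult_eq lin_ext_sum dp_unit)
  qed
  have sumA: "sum g ?A = tensor_mult (monoid_product dp_natural) (dp_coproduct p) (basis_vec dp_one \<otimes> basis_vec q)"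
  proof -
    have vals: "g (I <+> points Q) = basis_vec (dp_class (sub_dposet P (points P - I)), dp_natural (dp_class (sub_dposet P I)) q)"
      if "I \<in> ideals P" for I
      using ideals_subset[OF that] by (simp add: g_def Plus_Diff sub empty sub_points Q dp_unit)
    have inj: "inj_on (\<lambda>I. I <+> points Q) (ideals P)"
      by (rule inj_onI) (simp add: Plus_eq_iff)
    have "sum g ?A = (\<Sum>I\<in>ideals P.
        basis_vec (dp_class (sub_dposet P (points P - I)), dp_natural (dp_class (sub_dposet P I)) q))"
      unfolding sum.reindex[OF inj] by (rule sum.cong) (simp_all add: vals)
    then show ?thesis
      by (simp add: P(2) dp_coproduct_class_sum[OF P(1)] tensor_mult_eq lin_ext_sum dp_unit)
  qed
  have inter: "?B \<inter> ?A = {{} <+> points Q}"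
    using empty_in_ideals[of P] points_in_ideals[of Q] by (auto simp: Plus_eq_iff)
  have both: "g ({} <+> points Q) = basis_vec p \<otimes> basis_vec q"
    by (simp add: g_def Plus_Diff sub empty sub_points P Q dp_unit)
  have "dp_coproduct (dp_natural p q) = sum g (?B \<union> ?A)"
    unfolding P(2) Q(2) dp_natural_class[OF P(1) Q(1)]
      dp_coproduct_class_sum[OF double_poset_natural[OF P(1) Q(1)]] ideals_natural
    by (simp add: g_def)
  also have "\<dots> = sum g ?B + sum g ?A - sum g (?B \<inter> ?A)"
    by (rule sum_Un) (simp_all add: finite_ideals P Q)
  finally show ?thesis
    by (simp only: sumA sumB inter both sum.insert sum.empty finite.emptyI empty_iff not_False_eq_True add_0_right)
qed

section \<open>The two structures on the space of double posets\<close>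

lemma H_eqs:
  "H_leadsto = monoid_product dp_leadsto" "H_natural = monoid_product dp_natural"
  "H_one = basis_vec dp_one" "H_coproduct = lin_ext dp_coproduct" "H_component = homogeneous dp_size"
  by (simp_all add: fun_eq_iff H_leadsto_def H_natural_def H_one_def H_coproduct_def H_component_def
      monoid_product_def dp_one_def homogeneous_def)

lemma dp_coproduct_one: "dp_coproduct dp_one = basis_vec (dp_one, dp_one)"
proof -
  have "ideals (empty_dposet :: nat dposet) = {{}}"
    by (auto simp: ideals_def empty_dposet_def)
  moreover have "points (empty_dposet :: nat dposet) = {}"
    by (simp add: empty_dposet_def)
  moreover have "sub_dposet (empty_dposet :: nat dposet) {} = empty_dposet"
    by (simp add: sub_dposet_def empty_dposet_def)
  ultimately show ?thesis
    by (simp add: dp_one_def dp_coproduct_class_sum double_poset_empty)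
qed

lemma unital_algebra_leadsto: "unital_algebra H_leadsto H_one"
  and unital_algebra_natural: "unital_algebra H_natural H_one"
  unfolding H_eqs
  by (rule unital_algebra_monoid_product; simp add: dp_leadsto_assoc dp_natural_assoc dp_unit)+

lemma counital_coalgebra_H: "counital_coalgebra H_coproduct (\<lambda>x. Poly_Mapping.lookup x dp_one)"
  unfolding H_eqs
  by (rule counital_coalgebra_lin_ext[OF dp_coproduct_coassoc dp_coproduct_counit])

text \<open>Cardinalities add up, so only the empty double poset can divide the empty one. The counit is therefore
  multiplicative.\<close>

lemma dp_leadsto_eq_one_iff: "dp_leadsto p q = dp_one \<longleftrightarrow> p = dp_one \<and> q = dp_one"
  by (simp flip: dp_size_eq_0_iff add: dp_size_leadsto)

lemma connected_bialgebra_H: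
  "connected_bialgebra H_leadsto (H_one :: dp \<Rightarrow>\<^sub>0 'k::field) H_coproduct
    (\<lambda>x. Poly_Mapping.lookup x dp_one) dp_size"
proof -
  interpret unital_algebra H_leadsto "H_one :: dp \<Rightarrow>\<^sub>0 'k" by (rule unital_algebra_leadsto)
  interpret counital_coalgebra H_coproduct "\<lambda>x :: dp \<Rightarrow>\<^sub>0 'k. Poly_Mapping.lookup x dp_one"
    by (rule counital_coalgebra_H)
  show ?thesis
  proof
    have "bilin (\<lambda>x y :: dp \<Rightarrow>\<^sub>0 'k. H_coproduct (H_leadsto x y))"
      by (rule flinear_bilin[OF comult_linear mult_bilin])
    moreover have "bilin (\<lambda>x y :: dp \<Rightarrow>\<^sub>0 'k. tensor_mult H_leadsto (H_coproduct x) (H_coproduct y))"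
      by (rule bilin_compose[OF bilin_tensor_mult comult_linear comult_linear])
    ultimately show "H_coproduct (H_leadsto x y) = tensor_mult H_leadsto (H_coproduct x) (H_coproduct y)"
      for x y :: "dp \<Rightarrow>\<^sub>0 'k"
      by (rule bilin_eqI) (simp only: H_eqs monoid_product_basis lin_ext_basis dp_coproduct_leadsto)
    show "Poly_Mapping.lookup (H_leadsto x y) dp_one = Poly_Mapping.lookup x dp_one * Poly_Mapping.lookup y dp_one"
      for x y :: "dp \<Rightarrow>\<^sub>0 'k"
      unfolding H_eqs by (rule lookup_monoid_product_unit[OF dp_leadsto_eq_one_iff])
    show "H_leadsto x y \<in> homogeneous dp_size (i + j)"
      if "x \<in> homogeneous dp_size i" "y \<in> homogeneous dp_size j" for x y :: "dp \<Rightarrow>\<^sub>0 'k" and i j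
      unfolding H_eqs by (rule monoid_product_homogeneous[OF dp_size_leadsto that])
    show "H_one \<in> (homogeneous dp_size 0 :: (dp \<Rightarrow>\<^sub>0 'k) set)"
      using basis_vec_homogeneous[of dp_one dp_size] dp_size_eq_0_iff[of dp_one] by (simp add: H_eqs)
    show "Poly_Mapping.keys (H_coproduct (basis_vec b) :: _ \<Rightarrow>\<^sub>0 'k) \<subseteq> {(a, c). dp_size a + dp_size c = dp_size b}" for b
      by (simp add: H_eqs keys_dp_coproduct)
  qed (auto simp: H_eqs dp_coproduct_one dp_size_eq_0_iff lookup_single when_def)
qed

text \<open>Unit, coproduct, counit and degree are the same for both products, so only the conditions on \<open>\<natural>\<close> differ from
  those of the bialgebra above.\<close>

lemma infinitesimal_hopf_algebra_H:
  "infinitesimal_hopf_algebra H_natural (H_one :: dp \<Rightarrow>\<^sub>0 'k::field) H_coproduct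
    (\<lambda>x. Poly_Mapping.lookup x dp_one) H_component"
proof -
  interpret C: connected_bialgebra H_leadsto "H_one :: dp \<Rightarrow>\<^sub>0 'k" H_coproduct
    "\<lambda>x. Poly_Mapping.lookup x dp_one" dp_size
    by (rule connected_bialgebra_H)
  interpret G: grading H_component H_leadsto "H_one :: dp \<Rightarrow>\<^sub>0 'k" H_coproduct
    "\<lambda>x. Poly_Mapping.lookup x dp_one"
    unfolding H_eqs(5) by (rule C.grading)
  interpret unital_algebra H_natural "H_one :: dp \<Rightarrow>\<^sub>0 'k" by (rule unital_algebra_natural)
  show ?thesis
  proof
    have "bilin (\<lambda>x y :: dp \<Rightarrow>\<^sub>0 'k. H_coproduct (H_natural x y))"
      by (rule flinear_bilin[OF C.comult_linear mult_bilin])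
    moreover have "bilin (\<lambda>x y :: dp \<Rightarrow>\<^sub>0 'k. tensor_mult H_natural (x \<otimes> H_one) (H_coproduct y) +
        tensor_mult H_natural (H_coproduct x) (H_one \<otimes> y) - x \<otimes> y)"
      by (intro bilin_diff bilin_add bilin_tensor bilin_compose[OF bilin_tensor_mult]
          bilin_flinear[OF bilin_tensor] C.comult_linear)
    ultimately show "H_coproduct (H_natural x y) = tensor_mult H_natural (x \<otimes> H_one) (H_coproduct y) +
        tensor_mult H_natural (H_coproduct x) (H_one \<otimes> y) - x \<otimes> y"
      for x y :: "dp \<Rightarrow>\<^sub>0 'k"
      by (rule bilin_eqI) (simp only: H_eqs monoid_product_basis lin_ext_basis dp_coproduct_natural)
    show "H_natural x y \<in> H_component (i + j)"
      if "x \<in> H_component i" "y \<in> H_component j" for x y :: "dp \<Rightarrow>\<^sub>0 'k" and i j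
      using that unfolding H_eqs by (rule monoid_product_homogeneous[OF dp_size_natural])
    show "free.dim (H_component 0 :: (dp \<Rightarrow>\<^sub>0 'k) set) = 1"
      unfolding H_eqs by (rule dim_homogeneous_0[OF dp_size_eq_0_iff])
  qed (simp_all add: G.unit_graded G.comult_graded G.counit_graded C.comult_unit)
qed

theorem proposition29:
  shows "\<exists>(\<epsilon> :: (dp \<Rightarrow>\<^sub>0 'k::field) \<Rightarrow> 'k) S.
    graded_hopf_algebra H_leadsto H_one H_coproduct \<epsilon> S H_component \<and>
    infinitesimal_hopf_algebra H_natural H_one H_coproduct \<epsilon> H_component"
  using connected_bialgebra.graded_hopf_algebra[OF connected_bialgebra_H] infinitesimal_hopf_algebra_H
  unfolding H_eqs(5) by blast

end
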